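(* Let $\mathbf u\in\mathbf X$ (with pressure $p\in Q$) solve the EMA-conserving Galerkin formulation: for all times $t$ and all $\mathbf v\in\mathbf X$, $q\in Q$, $$\Big(\frac{\partial\mathbf u}{\partial t}+2\mathbf D(\mathbf u)\mathbf u+(\operatorname{div}\mathbf u)\mathbf u,\mathbf v\Big)-(p,\operatorname{div}\mathbf v)+(q,\operatorname{div}\mathbf u)+\nu(\nabla\mathbf u,\nabla\mathbf v)=(\mathbf f,\mathbf v).$$ Let $\mathbf w_1$, $\mathbf w_2$ (for $d=3$) and $w$ (for 2D flow) be finite element vorticities associated with $\mathbf u$, i.e. solutions of the following problems. (V1) $\mathbf w_1(t)\in\mathbf X$ and a Lagrange multiplier $\eta_1(t)\in Q$ satisfy for all $\mathbf v\in\mathbf X$, $q\in Q$: $$\Big(\frac{\partial\mathbf w_1}{\partial t},\mathbf v\Big)+b(\mathbf u,\mathbf w_1,\mathbf v)-b(\mathbf w_1,\mathbf u,\mathbf v)+\nu(\nabla\mathbf w_1,\nabla\mathbf v)+(\eta_1,\operatorname{div}\mathbf v)-(q,\operatorname{div}\mathbf w_1)=(\operatorname{curl}\mathbf f,\mathbf v).$$ (V2) $\mathbf w_2(t)\in\mathbf X$ and a Lagrange multiplier $\eta_2(t)\in Q$ satisfy for all $\mathbf v\in\mathbf X$, $q\in Q$: $$\Big(\frac{\partial\mathbf w_2}{\partial t},\mathbf v\Big)+b(\mathbf u,\mathbf w_2,\mathbf v)-b(\mathbf w_2,\mathbf u,\mathbf v)+((\operatorname{div}\mathbf u)\mathbf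 w_2,\mathbf v)-((\operatorname{div}\mathbf w_2)\mathbf u,\mathbf v)+\nu(\nabla\mathbf w_2,\nabla\mathbf v)+(\eta_2,\operatorname{div}\mathbf v)-(q,\operatorname{div}\mathbf w_2)=(\operatorname{curl}\mathbf f,\mathbf v).$$ (V3) (2D flow) $w(t)\in X$ satisfies for all $v\in X$: $$(w_t,v)+(\mathbf u\cdot\nabla w,v)+\nu(\nabla w,\nabla v)+\tfrac12((\operatorname{div}\mathbf u)w,v)=(\operatorname{curl}\mathbf f,v).$$ Then the EMA-conserving formulation conserves helicity, 2D enstrophy and total vorticity in the sense that the following quantities are constant in time: (i) helicity $H=(\mathbf u,\mathbf w_1)$, if $\mathbf f=\mathbf 0$ and $\nu=0$; (ii) 2D enstrophy $H_{2D}=\frac12\|w\|^2$, if $\operatorname{curl}\mathbf f=\mathbf 0$ and $\nu=0$; (iii) total vorticity $W_i=(\mathbf w_2,\mathbf e_i)$, $i=1,2,3$.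
   Context: Notation: $\Omega\subset\mathbb R^d$, $d\in\{2,3\}$, is a domain; $(\cdot,\cdot)$ and $\|\cdot\|$ are the $L^2(\Omega)$ inner product and norm; $\nu$ is the kinematic viscosity; $\mathbf f$ is the external forcing; $\mathbf e_i$ are the coordinate vectors; $\mathbf D(\mathbf u)=\frac12(\nabla\mathbf u+(\nabla\mathbf u)^T)$; $b(\mathbf u,\mathbf v,\mathbf w)=(\mathbf u\cdot\nabla\mathbf v,\mathbf w)$. In 2D, the curl is the 3D curl of the field extended by $0$ in the third component; in (V3) $\operatorname{curl}\mathbf f$ denotes its (only nonzero) third component. Spaces: $\mathbf X\subset[H^1_0(\Omega)]^d$ and $Q\subset L^2(\Omega)$ are finite-dimensional finite element velocity and pressure spaces corresponding to an admissible triangulation of $\Omega$ and satisfying the inf-sup compatibility condition; for 2D flow, $X\subset H^1_0(\Omega)$ denotes the corresponding scalar finite element space, $w$ being identified with the vorticity vector $(0,0,w)^T$. The discrete velocity satisfies $(\operatorname{div}\mathbf u,q)=0$ for all $q\in Q$, but $\operatorname{div}\mathbf u$ need not vanish pointwise. Standing assumptions: there is a subset $\widehat\Omega\subsetneq\Omega$ such that $S=\Omega\setminus\widehat\Omega$ is a strip along $\partial\Omega$ (so that there is a strip of elements along the boundary) on which $\mathbf u$, $p$ and $\mathbf f$ vanish; the discrete vorticities are likewise assumed to be zero on and near $\partial\Omega$. For each $i$ there is an element $\chi(\mathbf e_i)\in\mathbf X$ with $\chi(\mathbf e_i)=\mathbf e_i$ on $\widehat\Omega$, defined arbitrarily on $S$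 so as to satisfy the zero boundary conditions.
   Formalization: For (iii) the Lagrange multiplier η_2 is additionally assumed to vanish on the strip S; without this (η_2, div χ(e_i)) can be nonzero, and total vorticity can fail to be conserved for some inf-sup stable finite element pairs. *)

theory Defs
  imports "HOL-Analysis.Analysis"
begin

section \<open>Square-integrable functions and weak derivatives\<close>

text \<open>
  Functions on \<open>\<Omega>\<close> are total functions on \<open>real ^ 'd\<close>; only their restriction to \<open>\<Omega>\<close>, up to
  null sets, enters the notions below. The inner product on \<open>real ^ 'n ^ 'm\<close> is the Frobenius
  product, so \<open>ip\<close> and \<open>l2norm\<close> also serve for gradients.
\<close>

definition L2 :: "(real ^ 'd) set \<Rightarrow> (real ^ 'd \<Rightarrow> 'b::euclidean_space) set" where
  "L2 \<Omega> = {f. f \<in> borel_measurable (lebesgue_on \<Omega>) \<and> integrable (lebesgue_on \<Omega>) (\<lambda>x. (norm (f x))\<^sup>2)}"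

definition ip :: "(real ^ 'd) set \<Rightarrow> (real ^ 'd \<Rightarrow> 'b::euclidean_space) \<Rightarrow> (real ^ 'd \<Rightarrow> 'b) \<Rightarrow> real" where
  "ip \<Omega> f g = (LINT x|lebesgue_on \<Omega>. f x \<bullet> g x)"

definition l2norm :: "(real ^ 'd) set \<Rightarrow> (real ^ 'd \<Rightarrow> 'b::euclidean_space) \<Rightarrow> real" where
  "l2norm \<Omega> f = sqrt (ip \<Omega> f f)"

definition vanishes_on :: "(real ^ 'd) set \<Rightarrow> (real ^ 'd \<Rightarrow> 'b::euclidean_space) \<Rightarrow> bool" where
  "vanishes_on S f \<longleftrightarrow> (AE x in lebesgue_on S. f x = 0)"

definition pd :: "'d::finite \<Rightarrow> (real ^ 'd \<Rightarrow> real) \<Rightarrow> real ^ 'd \<Rightarrow> real" where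
  "pd i \<phi> x = frechet_derivative \<phi> (at x) (axis i 1)"

primrec Ck :: "nat \<Rightarrow> (real ^ 'd::finite \<Rightarrow> real) \<Rightarrow> bool" where
  "Ck 0 \<phi> \<longleftrightarrow> continuous_on UNIV \<phi>"
| "Ck (Suc k) \<phi> \<longleftrightarrow> (\<forall>x. \<phi> differentiable (at x)) \<and> (\<forall>i. Ck k (pd i \<phi>))"

definition test_functions :: "(real ^ 'd) set \<Rightarrow> (real ^ 'd \<Rightarrow> real) set" where
  "test_functions \<Omega> = {\<phi>. (\<forall>k. Ck k \<phi>) \<and> compact (closure {x. \<phi> x \<noteq> 0}) \<and> closure {x. \<phi> x \<noteq> 0} \<subseteq> \<Omega>}"

definition has_weak_pd :: "(real ^ 'd) set \<Rightarrow> 'd \<Rightarrow> (real ^ 'd \<Rightarrow> real) \<Rightarrow> (real ^ 'd \<Rightarrow> real) \<Rightarrow> bool" where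
  "has_weak_pd \<Omega> i v g \<longleftrightarrow> g \<in> L2 \<Omega> \<and> (\<forall>\<phi>\<in>test_functions \<Omega>. ip \<Omega> v (pd i \<phi>) = - ip \<Omega> g \<phi>)"

text \<open>For \<open>v\<close> in \<open>H1\<close> the following is the weak partial derivative, unique up to null sets.\<close>

definition wpd :: "(real ^ 'd) set \<Rightarrow> 'd \<Rightarrow> (real ^ 'd \<Rightarrow> real) \<Rightarrow> real ^ 'd \<Rightarrow> real" where
  "wpd \<Omega> i v = (SOME g. has_weak_pd \<Omega> i v g)"

definition H1 :: "(real ^ 'd) set \<Rightarrow> (real ^ 'd \<Rightarrow> real) set" where
  "H1 \<Omega> = {v \<in> L2 \<Omega>. \<forall>i. \<exists>g. has_weak_pd \<Omega> i v g}"

definition H10 :: "(real ^ 'd) set \<Rightarrow> (real ^ 'd \<Rightarrow> real) set" where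
  "H10 \<Omega> = {v \<in> H1 \<Omega>. \<exists>\<phi>. (\<forall>n::nat. \<phi> n \<in> test_functions \<Omega>)
      \<and> (\<lambda>n. l2norm \<Omega> (\<lambda>x. \<phi> n x - v x)) \<longlonglongrightarrow> 0
      \<and> (\<forall>i. (\<lambda>n. l2norm \<Omega> (\<lambda>x. pd i (\<phi> n) x - wpd \<Omega> i v x)) \<longlonglongrightarrow> 0)}"

definition H10_vec :: "(real ^ 'd) set \<Rightarrow> (real ^ 'd \<Rightarrow> real ^ 'd) set" where
  "H10_vec \<Omega> = {v. \<forall>i. (\<lambda>x. v x $ i) \<in> H10 \<Omega>}"

definition sgrad :: "(real ^ 'd) set \<Rightarrow> (real ^ 'd \<Rightarrow> real) \<Rightarrow> real ^ 'd \<Rightarrow> real ^ 'd" where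
  "sgrad \<Omega> v x = (\<chi> j. wpd \<Omega> j v x)"

text \<open>Row \<open>i\<close> of the velocity gradient is the gradient of the \<open>i\<close>-th component, so that
  \<open>u \<cdot> \<nabla>v\<close> is \<open>grad \<Omega> v x *v u x\<close>.\<close>

definition grad :: "(real ^ 'd) set \<Rightarrow> (real ^ 'd \<Rightarrow> real ^ 'd) \<Rightarrow> real ^ 'd \<Rightarrow> real ^ 'd ^ 'd" where
  "grad \<Omega> v x = (\<chi> i j. wpd \<Omega> j (\<lambda>y. v y $ i) x)"

definition divg :: "(real ^ 'd) set \<Rightarrow> (real ^ 'd \<Rightarrow> real ^ 'd) \<Rightarrow> real ^ 'd \<Rightarrow> real" where
  "divg \<Omega> v x = (\<Sum>i\<in>UNIV. wpd \<Omega> i (\<lambda>y. v y $ i) x)"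

definition symgrad :: "(real ^ 'd) set \<Rightarrow> (real ^ 'd \<Rightarrow> real ^ 'd) \<Rightarrow> real ^ 'd \<Rightarrow> real ^ 'd ^ 'd" where
  "symgrad \<Omega> v x = (1/2) *\<^sub>R (grad \<Omega> v x + transpose (grad \<Omega> v x))"

definition conv :: "(real ^ 'd) set \<Rightarrow> (real ^ 'd \<Rightarrow> real ^ 'd) \<Rightarrow> (real ^ 'd \<Rightarrow> real ^ 'd) \<Rightarrow> (real ^ 'd \<Rightarrow> real ^ 'd) \<Rightarrow> real" where
  "conv \<Omega> u v w = ip \<Omega> (\<lambda>x. grad \<Omega> v x *v u x) w"


section \<open>Curl of the forcing\<close>

text \<open>The forcing need not be differentiable: its curl is the weak one, assumed to be square
  integrable.\<close>

definition test_curl :: "(real ^ 3 \<Rightarrow> real ^ 3) \<Rightarrow> real ^ 3 \<Rightarrow> real ^ 3" where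
  "test_curl \<phi> x = vector
     [pd 2 (\<lambda>y. \<phi> y $ 3) x - pd 3 (\<lambda>y. \<phi> y $ 2) x,
      pd 3 (\<lambda>y. \<phi> y $ 1) x - pd 1 (\<lambda>y. \<phi> y $ 3) x,
      pd 1 (\<lambda>y. \<phi> y $ 2) x - pd 2 (\<lambda>y. \<phi> y $ 1) x]"

definition has_weak_curl :: "(real ^ 3) set \<Rightarrow> (real ^ 3 \<Rightarrow> real ^ 3) \<Rightarrow> (real ^ 3 \<Rightarrow> real ^ 3) \<Rightarrow> bool" where
  "has_weak_curl \<Omega> f g \<longleftrightarrow> g \<in> L2 \<Omega> \<and>
     (\<forall>\<phi>. (\<forall>i. (\<lambda>x. \<phi> x $ i) \<in> test_functions \<Omega>) \<longrightarrow> ip \<Omega> f (test_curl \<phi>) = ip \<Omega> g \<phi>)"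

definition wcurl :: "(real ^ 3) set \<Rightarrow> (real ^ 3 \<Rightarrow> real ^ 3) \<Rightarrow> real ^ 3 \<Rightarrow> real ^ 3" where
  "wcurl \<Omega> f = (SOME g. has_weak_curl \<Omega> f g)"

text \<open>The third component \<open>\<partial>\<^sub>1 f\<^sub>2 - \<partial>\<^sub>2 f\<^sub>1\<close> of the curl of the planar field extended by \<open>0\<close>.\<close>

definition has_weak_curl_2D :: "(real ^ 2) set \<Rightarrow> (real ^ 2 \<Rightarrow> real ^ 2) \<Rightarrow> (real ^ 2 \<Rightarrow> real) \<Rightarrow> bool" where
  "has_weak_curl_2D \<Omega> f g \<longleftrightarrow> g \<in> L2 \<Omega> \<and>
     (\<forall>\<phi>\<in>test_functions \<Omega>. ip \<Omega> f (\<lambda>x. vector [pd 2 \<phi> x, - pd 1 \<phi> x]) = ip \<Omega> g \<phi>)"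

definition wcurl_2D :: "(real ^ 2) set \<Rightarrow> (real ^ 2 \<Rightarrow> real ^ 2) \<Rightarrow> real ^ 2 \<Rightarrow> real" where
  "wcurl_2D \<Omega> f = (SOME g. has_weak_curl_2D \<Omega> f g)"


section \<open>Finite element spaces\<close>

definition admissible_mesh :: "(real ^ 'd) set \<Rightarrow> (real ^ 'd) set set \<Rightarrow> bool" where
  "admissible_mesh \<Omega> \<T> \<longleftrightarrow> triangulation \<T>
     \<and> (\<forall>T\<in>\<T>. int CARD('d) simplex T \<and> interior T \<subseteq> \<Omega>) \<and> \<Union>\<T> = closure \<Omega>"

text \<open>Values on element boundaries are left open, since pressures may be discontinuous there;
  continuity of velocities is encoded in their membership in \<open>H10_vec\<close>.\<close>

definition fe_space :: "(real ^ 'd) set set \<Rightarrow> (real ^ 'd \<Rightarrow> 'b::euclidean_space) set \<Rightarrow> bool" where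
  "fe_space \<T> V \<longleftrightarrow>
     (\<exists>B. finite B \<and> V = range (\<lambda>c::(real ^ 'd \<Rightarrow> 'b) \<Rightarrow> real. \<lambda>x. \<Sum>b\<in>B. c b *\<^sub>R b x))
     \<and> (\<forall>v\<in>V. \<forall>T\<in>\<T>. \<exists>P. polynomial_function P \<and> (\<forall>x\<in>interior T. v x = P x))"

text \<open>The infimum and suprema are taken in the extended reals, where they always exist.\<close>

definition inf_sup :: "(real ^ 'd) set \<Rightarrow> (real ^ 'd \<Rightarrow> real ^ 'd) set \<Rightarrow> (real ^ 'd \<Rightarrow> real) set \<Rightarrow> bool" where
  "inf_sup \<Omega> X Q \<longleftrightarrow> (\<exists>\<beta>>0. ereal \<beta> \<le>
     (INF q\<in>{q \<in> Q. l2norm \<Omega> q \<noteq> 0}. SUP v\<in>{v \<in> X. l2norm \<Omega> (grad \<Omega> v) \<noteq> 0}.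
        ereal (ip \<Omega> q (divg \<Omega> v) / (l2norm \<Omega> (grad \<Omega> v) * l2norm \<Omega> q))))"

text \<open>\<open>\<Omega> - \<Omega>h\<close> is a union of elements of the mesh that includes all those touching the boundary.\<close>

definition boundary_strip :: "(real ^ 'd) set \<Rightarrow> (real ^ 'd) set set \<Rightarrow> (real ^ 'd) set \<Rightarrow> bool" where
  "boundary_strip \<Omega> \<T> \<Omega>h \<longleftrightarrow> \<Omega>h \<subset> \<Omega> \<and>
     (\<exists>\<S>\<subseteq>\<T>. \<Omega> - \<Omega>h = \<Omega> \<inter> \<Union>\<S> \<and> (\<forall>T\<in>\<T>. T \<inter> frontier \<Omega> \<noteq> {} \<longrightarrow> T \<in> \<S>))"

locale fe_discretization =
  fixes \<Omega> :: "(real ^ 'd) set"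
    and \<T> :: "(real ^ 'd) set set"
    and X :: "(real ^ 'd \<Rightarrow> real ^ 'd) set"
    and Q :: "(real ^ 'd \<Rightarrow> real) set"
    and \<Omega>h :: "(real ^ 'd) set"
  assumes domain: "open \<Omega>" "connected \<Omega>" "\<Omega> \<noteq> {}"
    and mesh: "admissible_mesh \<Omega> \<T>"
    and velocity_space: "fe_space \<T> X" "X \<subseteq> H10_vec \<Omega>"
    and pressure_space: "fe_space \<T> Q" "Q \<subseteq> L2 \<Omega>"
    and stable: "inf_sup \<Omega> X Q"
    and strip: "boundary_strip \<Omega> \<T> \<Omega>h"
    and cutoff: "\<forall>i. \<exists>c\<in>X. AE x in lebesgue_on \<Omega>h. c x = axis i 1"


section \<open>The discrete flow and the discrete vorticities\<close>

text \<open>Time derivatives are derivatives of \<open>L2\<close>-valued functions, one-sided at endpoints of \<open>I\<close>.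
  On a finite-dimensional space this is differentiability of the coefficients.\<close>

definition has_time_derivative ::
  "(real ^ 'd) set \<Rightarrow> real set \<Rightarrow> (real \<Rightarrow> real ^ 'd \<Rightarrow> 'b::euclidean_space) \<Rightarrow> real \<Rightarrow> (real ^ 'd \<Rightarrow> 'b) \<Rightarrow> bool" where
  "has_time_derivative \<Omega> I u t g \<longleftrightarrow> g \<in> L2 \<Omega> \<and>
     ((\<lambda>s. l2norm \<Omega> (\<lambda>x. (u s x - u t x) /\<^sub>R (s - t) - g x)) \<longlongrightarrow> 0) (at t within I)"

locale ema_flow = fe_discretization \<Omega> \<T> X Q \<Omega>h
  for \<Omega> :: "(real ^ 'd) set" and \<T> X Q \<Omega>h +
  fixes I :: "real set"
    and \<nu> :: real
    and f u :: "real \<Rightarrow> real ^ 'd \<Rightarrow> real ^ 'd"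
    and p :: "real \<Rightarrow> real ^ 'd \<Rightarrow> real"
  assumes forcing: "\<forall>t\<in>I. f t \<in> L2 \<Omega>"
    and discrete: "\<forall>t\<in>I. u t \<in> X \<and> p t \<in> Q"
    and ema: "\<forall>t\<in>I. \<exists>ut. has_time_derivative \<Omega> I u t ut \<and> (\<forall>v\<in>X. \<forall>q\<in>Q.
          ip \<Omega> (\<lambda>x. ut x + 2 *\<^sub>R (symgrad \<Omega> (u t) x *v u t x) + divg \<Omega> (u t) x *\<^sub>R u t x) v
          - ip \<Omega> (p t) (divg \<Omega> v) + ip \<Omega> q (divg \<Omega> (u t)) + \<nu> * ip \<Omega> (grad \<Omega> (u t)) (grad \<Omega> v)
        = ip \<Omega> (f t) v)"
    and vanish: "\<forall>t\<in>I. vanishes_on (\<Omega> - \<Omega>h) (u t) \<and> vanishes_on (\<Omega> - \<Omega>h) (p t)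
                     \<and> vanishes_on (\<Omega> - \<Omega>h) (f t)"

definition solves_V1 ::
  "(real ^ 3) set \<Rightarrow> (real ^ 3 \<Rightarrow> real ^ 3) set \<Rightarrow> (real ^ 3 \<Rightarrow> real) set \<Rightarrow> real set \<Rightarrow> real
   \<Rightarrow> (real \<Rightarrow> real ^ 3 \<Rightarrow> real ^ 3) \<Rightarrow> (real \<Rightarrow> real ^ 3 \<Rightarrow> real ^ 3)
   \<Rightarrow> (real \<Rightarrow> real ^ 3 \<Rightarrow> real ^ 3) \<Rightarrow> (real \<Rightarrow> real ^ 3 \<Rightarrow> real) \<Rightarrow> bool" where
  "solves_V1 \<Omega> X Q I \<nu> f u w \<eta> \<longleftrightarrow> (\<forall>t\<in>I. w t \<in> X \<and> \<eta> t \<in> Q \<and>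
     (\<exists>wt. has_time_derivative \<Omega> I w t wt \<and> (\<forall>v\<in>X. \<forall>q\<in>Q.
        ip \<Omega> wt v + conv \<Omega> (u t) (w t) v - conv \<Omega> (w t) (u t) v
        + \<nu> * ip \<Omega> (grad \<Omega> (w t)) (grad \<Omega> v)
        + ip \<Omega> (\<eta> t) (divg \<Omega> v) - ip \<Omega> q (divg \<Omega> (w t))
      = ip \<Omega> (wcurl \<Omega> (f t)) v)))"

definition solves_V2 ::
  "(real ^ 3) set \<Rightarrow> (real ^ 3 \<Rightarrow> real ^ 3) set \<Rightarrow> (real ^ 3 \<Rightarrow> real) set \<Rightarrow> real set \<Rightarrow> real
   \<Rightarrow> (real \<Rightarrow> real ^ 3 \<Rightarrow> real ^ 3) \<Rightarrow> (real \<Rightarrow> real ^ 3 \<Rightarrow> real ^ 3)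
   \<Rightarrow> (real \<Rightarrow> real ^ 3 \<Rightarrow> real ^ 3) \<Rightarrow> (real \<Rightarrow> real ^ 3 \<Rightarrow> real) \<Rightarrow> bool" where
  "solves_V2 \<Omega> X Q I \<nu> f u w \<eta> \<longleftrightarrow> (\<forall>t\<in>I. w t \<in> X \<and> \<eta> t \<in> Q \<and>
     (\<exists>wt. has_time_derivative \<Omega> I w t wt \<and> (\<forall>v\<in>X. \<forall>q\<in>Q.
        ip \<Omega> wt v + conv \<Omega> (u t) (w t) v - conv \<Omega> (w t) (u t) v
        + ip \<Omega> (\<lambda>x. divg \<Omega> (u t) x *\<^sub>R w t x) v - ip \<Omega> (\<lambda>x. divg \<Omega> (w t) x *\<^sub>R u t x) v
        + \<nu> * ip \<Omega> (grad \<Omega> (w t)) (grad \<Omega> v)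
        + ip \<Omega> (\<eta> t) (divg \<Omega> v) - ip \<Omega> q (divg \<Omega> (w t))
      = ip \<Omega> (wcurl \<Omega> (f t)) v)))"

definition solves_V3 ::
  "(real ^ 2) set \<Rightarrow> (real ^ 2 \<Rightarrow> real) set \<Rightarrow> real set \<Rightarrow> real
   \<Rightarrow> (real \<Rightarrow> real ^ 2 \<Rightarrow> real ^ 2) \<Rightarrow> (real \<Rightarrow> real ^ 2 \<Rightarrow> real ^ 2)
   \<Rightarrow> (real \<Rightarrow> real ^ 2 \<Rightarrow> real) \<Rightarrow> bool" where
  "solves_V3 \<Omega> Y I \<nu> f u w \<longleftrightarrow> (\<forall>t\<in>I. w t \<in> Y \<and>
     (\<exists>wt. has_time_derivative \<Omega> I w t wt \<and> (\<forall>v\<in>Y.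
        ip \<Omega> wt v + ip \<Omega> (\<lambda>x. u t x \<bullet> sgrad \<Omega> (w t) x) v
        + \<nu> * ip \<Omega> (sgrad \<Omega> (w t)) (sgrad \<Omega> v)
        + 1/2 * ip \<Omega> (\<lambda>x. divg \<Omega> (u t) x * w t x) v
      = ip \<Omega> (wcurl_2D \<Omega> (f t)) v)))"

end

theory Submission
  imports Defs
begin

text \<open>
  In a triple product rule such as
  \<open>(u \<cdot> \<nabla>v, w) + (u \<cdot> \<nabla>w, v) + ((div u) v, w) = \<integral> div ((v \<cdot> w) u) = 0\<close>, every factor is
  essentially bounded, because finite element functions are piecewise polynomial, and is an \<open>L2\<close>-limit,
  together with its gradient, of test functions; this is all that integration by parts needs.
  Helicity: test the momentum equation with \<open>w\<^sub>1\<close> and (V1) with \<open>u\<close>; the pressure and the multiplier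
  drop out since \<open>u\<close> and \<open>w\<^sub>1\<close> are discretely divergence free, and the rest cancels by the identity with
  \<open>v = u\<close>. Enstrophy: test (V3) with \<open>w\<close>. Total vorticity: test (V2) with a cutoff \<open>c\<close> of \<open>e\<^sub>i\<close>.
  Since \<open>\<nabla>c\<close> vanishes where \<open>c\<close> is constant and \<open>w\<^sub>2\<close>, \<open>\<nabla>w\<^sub>2\<close>, \<open>u\<close>, \<open>f\<close> and the multiplier vanish
  on the strip, the viscous, multiplier and forcing terms are zero, and the convective terms are
  integrals of the divergences of \<open>w\<^sub>2\<^sub>,\<^sub>i u\<close> and \<open>u\<^sub>i w\<^sub>2\<close>.
  That weak gradients vanish where a function is constant rests on smooth bump functions.
\<close>

section \<open>Square-integrable functions\<close>

text \<open>The integrand is dominated by the sum of the two squared norms, by Cauchy-Schwarz and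
  the arithmetic-geometric mean inequality.\<close>

lemma integrable_inner_L2:
  assumes "f \<in> L2 \<Omega>" "g \<in> L2 \<Omega>"
  shows "integrable (lebesgue_on \<Omega>) (\<lambda>x. f x \<bullet> g x)"
proof (rule Bochner_Integration.integrable_bound)
  show "integrable (lebesgue_on \<Omega>) (\<lambda>x. (norm (f x))\<^sup>2 + (norm (g x))\<^sup>2)"
    using assms by (auto simp: L2_def)
  have [measurable]: "f \<in> borel_measurable (lebesgue_on \<Omega>)" "g \<in> borel_measurable (lebesgue_on \<Omega>)"
    using assms by (auto simp: L2_def)
  show "(\<lambda>x. f x \<bullet> g x) \<in> borel_measurable (lebesgue_on \<Omega>)" by measurable
  have "\<bar>a \<bullet> b\<bar> \<le> (norm a)\<^sup>2 + (norm b)\<^sup>2" for a b :: 'b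
  proof -
    have "\<bar>a \<bullet> b\<bar> \<le> norm a * norm b" by (rule Cauchy_Schwarz_ineq2)
    moreover have "2 * (norm a * norm b) \<le> (norm a)\<^sup>2 + (norm b)\<^sup>2"
      using sum_squares_bound[of "norm a" "norm b"] by simp
    moreover have "0 \<le> norm a * norm b" by simp
    ultimately show ?thesis by linarith
  qed
  then show "AE x in lebesgue_on \<Omega>. norm (f x \<bullet> g x) \<le> norm ((norm (f x))\<^sup>2 + (norm (g x))\<^sup>2)"
    by (intro AE_I2) (smt (verit) real_norm_def zero_le_power2)
qed

lemma L2_measurable: "f \<in> L2 \<Omega> \<Longrightarrow> f \<in> borel_measurable (lebesgue_on \<Omega>)"
  by (simp add: L2_def)

lemma L2_add:
  assumes "f \<in> L2 \<Omega>" "g \<in> L2 \<Omega>"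
  shows "(\<lambda>x. f x + g x) \<in> L2 \<Omega>"
proof -
  have "integrable (lebesgue_on \<Omega>) (\<lambda>x. (f x \<bullet> f x + g x \<bullet> g x) + 2 * (f x \<bullet> g x))"
    using assms by (intro Bochner_Integration.integrable_add integrable_mult_right integrable_inner_L2)
  then show ?thesis
    using assms by (auto simp: L2_def power2_norm_eq_inner inner_simps inner_commute algebra_simps)
qed

lemma L2_scaleR: "f \<in> L2 \<Omega> \<Longrightarrow> (\<lambda>x. c *\<^sub>R f x) \<in> L2 \<Omega>"
  by (auto simp: L2_def power_mult_distrib)

lemma L2_diff: "f \<in> L2 \<Omega> \<Longrightarrow> g \<in> L2 \<Omega> \<Longrightarrow> (\<lambda>x. f x - g x) \<in> L2 \<Omega>"
  using L2_add[of f \<Omega> "\<lambda>x. (-1) *\<^sub>R g x"] L2_scaleR[of g \<Omega> "-1"] by simp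

lemma L2_zero: "(\<lambda>x. 0) \<in> L2 \<Omega>"
  by (simp add: L2_def)

lemma L2_sum: "(\<And>i. i \<in> A \<Longrightarrow> f i \<in> L2 \<Omega>) \<Longrightarrow> (\<lambda>x. \<Sum>i\<in>A. f i x) \<in> L2 \<Omega>"
  by (induction A rule: infinite_finite_induct) (auto simp: L2_zero L2_add)

text \<open>Domination criterion behind the \<open>L2\<close> membership of components and of
  products with an essentially bounded factor.\<close>

lemma L2_bound:
  assumes f: "f \<in> L2 \<Omega>" and g: "g \<in> borel_measurable (lebesgue_on \<Omega>)"
    and le: "AE x in lebesgue_on \<Omega>. norm (g x) \<le> M * norm (f x)"
  shows "g \<in> L2 \<Omega>"
proof -
  have "integrable (lebesgue_on \<Omega>) (\<lambda>x. (norm (g x))\<^sup>2)"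
  proof (rule Bochner_Integration.integrable_bound)
    show "integrable (lebesgue_on \<Omega>) (\<lambda>x. M\<^sup>2 * (norm (f x))\<^sup>2)"
      using f by (auto simp: L2_def)
    show "(\<lambda>x. (norm (g x))\<^sup>2) \<in> borel_measurable (lebesgue_on \<Omega>)"
      using g by measurable
    show "AE x in lebesgue_on \<Omega>. norm ((norm (g x))\<^sup>2) \<le> norm (M\<^sup>2 * (norm (f x))\<^sup>2)"
      using le
    proof eventually_elim
      case (elim x)
      then have "(norm (g x))\<^sup>2 \<le> (M * norm (f x))\<^sup>2" by (rule power_mono) simp
      then show ?case by (simp add: power_mult_distrib)
    qed
  qed
  with g show ?thesis by (simp add: L2_def)
qed

lemma borel_measurable_nth:
  fixes f :: "'a \<Rightarrow> 'b::euclidean_space ^ 'n"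
  assumes "f \<in> borel_measurable M"
  shows "(\<lambda>x. f x $ i) \<in> borel_measurable M"
  by (rule borel_measurable_continuous_on[OF _ assms]) (intro continuous_intros)

lemma L2_component: "f \<in> L2 \<Omega> \<Longrightarrow> (\<lambda>x. f x $ i) \<in> L2 \<Omega>"
  by (rule L2_bound[where f = f and M = 1])
    (simp_all add: borel_measurable_nth L2_measurable Finite_Cartesian_Product.norm_nth_le)

text \<open>Every basis vector of the product type is \<open>axis i c\<close> with \<open>c\<close>
  a basis vector, so each coordinate function factors through one component.\<close>

lemma borel_measurable_vec:
  fixes f :: "'a \<Rightarrow> 'b::euclidean_space ^ 'n"
  assumes "\<And>i. (\<lambda>x. f x $ i) \<in> borel_measurable M"
  shows "f \<in> borel_measurable M"
proof (rule borel_measurable_euclidean_space[THEN iffD2], rule ballI)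
  fix b :: "'b ^ 'n" assume "b \<in> Basis"
  then obtain i c where b: "b = axis i c" by (auto simp: Basis_vec_def)
  have "(\<lambda>x. f x $ i \<bullet> c) \<in> borel_measurable M"
    using assms[of i] by measurable
  then show "(\<lambda>x. f x \<bullet> b) \<in> borel_measurable M" by (simp add: b inner_axis)
qed

lemma L2_vec:
  fixes f :: "real ^ 'd \<Rightarrow> 'b::euclidean_space ^ 'n"
  assumes "\<And>i. (\<lambda>x. f x $ i) \<in> L2 \<Omega>"
  shows "f \<in> L2 \<Omega>"
proof -
  have "integrable (lebesgue_on \<Omega>) (\<lambda>x. \<Sum>i\<in>UNIV. (f x $ i) \<bullet> (f x $ i))"
    using assms by (intro Bochner_Integration.integrable_sum integrable_inner_L2)
  moreover have "f \<in> borel_measurable (lebesgue_on \<Omega>)"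
    using assms by (intro borel_measurable_vec L2_measurable)
  ultimately show ?thesis by (simp add: L2_def power2_norm_eq_inner inner_vec_def)
qed

section \<open>Bilinearity, Cauchy-Schwarz and limits for the \<open>L2\<close> inner
  product\<close>

lemma ip_commute: "ip \<Omega> f g = ip \<Omega> g f"
  by (simp add: ip_def inner_commute)

lemma ip_add_left:
  assumes "f \<in> L2 \<Omega>" "g \<in> L2 \<Omega>" "h \<in> L2 \<Omega>"
  shows "ip \<Omega> (\<lambda>x. f x + g x) h = ip \<Omega> f h + ip \<Omega> g h"
  using assms by (simp add: ip_def inner_simps integrable_inner_L2)

lemma ip_scaleR_left: "ip \<Omega> (\<lambda>x. c *\<^sub>R f x) h = c * ip \<Omega> f h"
  by (simp add: ip_def)

lemma ip_diff_left:
  assumes "f \<in> L2 \<Omega>" "g \<in> L2 \<Omega>" "h \<in> L2 \<Omega>"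
  shows "ip \<Omega> (\<lambda>x. f x - g x) h = ip \<Omega> f h - ip \<Omega> g h"
  using assms by (simp add: ip_def inner_simps integrable_inner_L2)

lemma ip_add_right:
  assumes "f \<in> L2 \<Omega>" "g \<in> L2 \<Omega>" "h \<in> L2 \<Omega>"
  shows "ip \<Omega> h (\<lambda>x. f x + g x) = ip \<Omega> h f + ip \<Omega> h g"
  using assms by (simp add: ip_def inner_simps integrable_inner_L2)

lemma ip_scaleR_right: "ip \<Omega> h (\<lambda>x. c *\<^sub>R f x) = c * ip \<Omega> h f"
  by (simp add: ip_def)

lemma ip_diff_right:
  assumes "f \<in> L2 \<Omega>" "g \<in> L2 \<Omega>" "h \<in> L2 \<Omega>"
  shows "ip \<Omega> h (\<lambda>x. f x - g x) = ip \<Omega> h f - ip \<Omega> h g"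
  using assms by (simp add: ip_def inner_simps integrable_inner_L2)

text \<open>Only the pointwise products are compared, so both factors may change type or exchange
  scalar factors. Measurability is what lets an almost-everywhere equality pass to the
  integrals.\<close>

lemma ip_cong_AE:
  assumes "AE x in lebesgue_on \<Omega>. f x \<bullet> g x = f' x \<bullet> g' x"
    and "f \<in> borel_measurable (lebesgue_on \<Omega>)" "g \<in> borel_measurable (lebesgue_on \<Omega>)"
    and "f' \<in> borel_measurable (lebesgue_on \<Omega>)" "g' \<in> borel_measurable (lebesgue_on \<Omega>)"
  shows "ip \<Omega> f g = ip \<Omega> f' g'"
  unfolding ip_def using assms by (intro integral_cong_AE) auto

lemma ip_eq_0_AE:
  assumes "AE x in lebesgue_on \<Omega>. f x \<bullet> g x = 0"
  shows "ip \<Omega> f g = 0"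
  unfolding ip_def using assms by (rule integral_eq_zero_AE)

lemma ip_self_nonneg: "0 \<le> ip \<Omega> f f"
  by (simp add: ip_def)

text \<open>The squared norm of \<open>f + t g\<close> is a quadratic polynomial in \<open>t\<close>
  that is never negative; a suitable \<open>t\<close> gives the bound.\<close>

lemma ip_Cauchy_Schwarz:
  assumes f: "f \<in> L2 \<Omega>" and g: "g \<in> L2 \<Omega>"
  shows "\<bar>ip \<Omega> f g\<bar> \<le> l2norm \<Omega> f * l2norm \<Omega> g"
proof -
  have pos: "0 \<le> ip \<Omega> f f + 2 * t * ip \<Omega> f g + t\<^sup>2 * ip \<Omega> g g" for t
  proof -
    have "0 \<le> ip \<Omega> (\<lambda>x. f x + t *\<^sub>R g x) (\<lambda>x. f x + t *\<^sub>R g x)"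
      by (rule ip_self_nonneg)
    also have "\<dots> = ip \<Omega> f f + 2 * t * ip \<Omega> f g + t\<^sup>2 * ip \<Omega> g g"
      using f g L2_scaleR[OF g, of t] L2_add[OF f L2_scaleR[OF g, of t]]
      by (simp add: ip_add_left ip_add_right ip_scaleR_left ip_scaleR_right ip_commute[of _ g f]
          power2_eq_square algebra_simps)
    finally show ?thesis .
  qed
  have "(ip \<Omega> f g)\<^sup>2 \<le> ip \<Omega> f f * ip \<Omega> g g"
  proof (cases "ip \<Omega> g g = 0")
    case True
    have "ip \<Omega> f g = 0"
    proof (rule ccontr)
      assume "ip \<Omega> f g \<noteq> 0"
      then show False
        \<comment> \<open>If \<open>g\<close> has norm 0, the polynomial is affine in
          \<open>t\<close>; this \<open>t\<close> would give it the value -1.\<close>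
        using pos[of "- (ip \<Omega> f f + 1) / (2 * ip \<Omega> f g)"] True by (simp add: field_simps)
    qed
    then show ?thesis using True by simp
  next
    case False
    then have "0 < ip \<Omega> g g" using ip_self_nonneg[of \<Omega> g] by simp
    then show ?thesis
      \<comment> \<open>This is the minimiser of the quadratic polynomial.\<close>
      using pos[of "- ip \<Omega> f g / ip \<Omega> g g"] by (simp add: field_simps power2_eq_square)
  qed
  then have "sqrt ((ip \<Omega> f g)\<^sup>2) \<le> sqrt (ip \<Omega> f f * ip \<Omega> g g)"
    by (rule real_sqrt_le_mono)
  then show ?thesis by (simp add: l2norm_def real_sqrt_mult)
qed

text \<open>Norm convergence implies weak convergence, by Cauchy-Schwarz. Membership in
  \<open>L2\<close> is asked only eventually, because difference quotients in time are controlled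
  only at times in \<open>I\<close>.\<close>

lemma ip_tendsto:
  assumes lim: "((\<lambda>n. l2norm \<Omega> (\<lambda>x. f n x - f0 x)) \<longlongrightarrow> 0) F"
    and f: "\<forall>\<^sub>F n in F. f n \<in> L2 \<Omega>" and f0: "f0 \<in> L2 \<Omega>" and g: "g \<in> L2 \<Omega>"
  shows "((\<lambda>n. ip \<Omega> (f n) g) \<longlongrightarrow> ip \<Omega> f0 g) F"
proof (rule Lim_null[THEN iffD2], rule Lim_null_comparison)
  show "\<forall>\<^sub>F n in F. norm (ip \<Omega> (f n) g - ip \<Omega> f0 g) \<le> l2norm \<Omega> (\<lambda>x. f n x - f0 x) * l2norm \<Omega> g"
    using f
  proof eventually_elim
    case (elim n)
    show ?case
      using ip_Cauchy_Schwarz[OF L2_diff[OF elim f0] g] by (simp add: ip_diff_left elim f0 g)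
  qed
  show "((\<lambda>n. l2norm \<Omega> (\<lambda>x. f n x - f0 x) * l2norm \<Omega> g) \<longlongrightarrow> 0) F"
    using tendsto_mult_left_zero[OF lim] by simp
qed

text \<open>With difference quotients \<open>du\<close> and \<open>dw\<close>, the quotient of the
  inner product is exactly \<open>(du, w t) + (dw, u t) + (s - t) (du, dw)\<close>. The first two
  terms converge to the claimed derivative, and the last tends to 0 because \<open>(du, dw)\<close>
  has a limit.\<close>

lemma ip_time_derivative:
  assumes u: "\<And>s. s \<in> I \<Longrightarrow> u s \<in> L2 \<Omega>" and w: "\<And>s. s \<in> I \<Longrightarrow> w s \<in> L2 \<Omega>"
    and t: "t \<in> I"
    and ut: "has_time_derivative \<Omega> I u t ut" and wt: "has_time_derivative \<Omega> I w t wt"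
  shows "((\<lambda>s. ip \<Omega> (u s) (w s)) has_real_derivative (ip \<Omega> ut (w t) + ip \<Omega> wt (u t))) (at t within I)"
proof -
  let ?F = "at t within I"
  define du where "du s x = (u s x - u t x) /\<^sub>R (s - t)" for s x
  define dw where "dw s x = (w s x - w t x) /\<^sub>R (s - t)" for s x
  have utL: "ut \<in> L2 \<Omega>" and wtL: "wt \<in> L2 \<Omega>"
    and ul: "((\<lambda>s. l2norm \<Omega> (\<lambda>x. du s x - ut x)) \<longlongrightarrow> 0) ?F"
    and wl: "((\<lambda>s. l2norm \<Omega> (\<lambda>x. dw s x - wt x)) \<longlongrightarrow> 0) ?F"
    using ut wt by (auto simp: has_time_derivative_def du_def dw_def)
  have duL: "du s \<in> L2 \<Omega>" if "s \<in> I" for s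
    unfolding du_def using u[OF that] u[OF t] by (intro L2_scaleR L2_diff)
  have dwL: "dw s \<in> L2 \<Omega>" if "s \<in> I" for s
    unfolding dw_def using w[OF that] w[OF t] by (intro L2_scaleR L2_diff)
  have ev: "\<forall>\<^sub>F s in ?F. s \<in> I \<and> s \<noteq> t" by (auto simp: eventually_at_filter)
  have du1: "((\<lambda>s. ip \<Omega> (du s) (w t)) \<longlongrightarrow> ip \<Omega> ut (w t)) ?F"
    using ul utL w[OF t] by (rule_tac ip_tendsto) (auto intro: eventually_mono[OF ev] duL)
  have dw1: "((\<lambda>s. ip \<Omega> (dw s) (u t)) \<longlongrightarrow> ip \<Omega> wt (u t)) ?F"
    using wl wtL u[OF t] by (rule_tac ip_tendsto) (auto intro: eventually_mono[OF ev] dwL)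
  have dw2: "((\<lambda>s. ip \<Omega> (dw s) ut) \<longlongrightarrow> ip \<Omega> wt ut) ?F"
    using wl wtL utL by (rule_tac ip_tendsto) (auto intro: eventually_mono[OF ev] dwL)
  have du2: "((\<lambda>s. ip \<Omega> (du s) wt) \<longlongrightarrow> ip \<Omega> ut wt) ?F"
    using ul utL wtL by (rule_tac ip_tendsto) (auto intro: eventually_mono[OF ev] duL)
  \<comment> \<open>Here both factors vary with \<open>s\<close>, so weak convergence does not
    suffice; Cauchy-Schwarz bounds the pairing by a product of two null sequences.\<close>
  have small: "((\<lambda>s. ip \<Omega> (\<lambda>x. du s x - ut x) (\<lambda>x. dw s x - wt x)) \<longlongrightarrow> 0) ?F"
  proof (rule Lim_null_comparison)
    show "\<forall>\<^sub>F s in ?F. norm (ip \<Omega> (\<lambda>x. du s x - ut x) (\<lambda>x. dw s x - wt x))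
        \<le> l2norm \<Omega> (\<lambda>x. du s x - ut x) * l2norm \<Omega> (\<lambda>x. dw s x - wt x)"
      using ev by eventually_elim (auto intro!: ip_Cauchy_Schwarz L2_diff duL dwL utL wtL)
    show "((\<lambda>s. l2norm \<Omega> (\<lambda>x. du s x - ut x) * l2norm \<Omega> (\<lambda>x. dw s x - wt x)) \<longlongrightarrow> 0) ?F"
      using tendsto_mult[OF ul wl] by simp
  qed
  \<comment> \<open>Expanding the small pairing expresses \<open>(du, dw)\<close> through pairings
    with one fixed factor, whose limits are known.\<close>
  have rem: "((\<lambda>s. ip \<Omega> (du s) (dw s)) \<longlongrightarrow> ip \<Omega> ut wt) ?F"
  proof (rule Lim_transform_eventually)
    show "((\<lambda>s. ip \<Omega> (\<lambda>x. du s x - ut x) (\<lambda>x. dw s x - wt x)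
        + ip \<Omega> (dw s) ut + ip \<Omega> (du s) wt - ip \<Omega> ut wt) \<longlongrightarrow> ip \<Omega> ut wt) ?F"
      using tendsto_diff[OF tendsto_add[OF tendsto_add[OF small dw2] du2] tendsto_const[of "ip \<Omega> ut wt"]]
      by (simp add: ip_commute[of _ wt ut])
    show "\<forall>\<^sub>F s in ?F. ip \<Omega> (\<lambda>x. du s x - ut x) (\<lambda>x. dw s x - wt x)
        + ip \<Omega> (dw s) ut + ip \<Omega> (du s) wt - ip \<Omega> ut wt = ip \<Omega> (du s) (dw s)"
      using ev
    proof eventually_elim
      case (elim s)
      then have L: "du s \<in> L2 \<Omega>" "dw s \<in> L2 \<Omega>" using duL dwL by auto
      have "ip \<Omega> v (\<lambda>x. dw s x - wt x) = ip \<Omega> v (dw s) - ip \<Omega> v wt" if "v \<in> L2 \<Omega>" for v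
        using L wtL that by (simp add: ip_diff_right)
      then show ?case
        using L wtL utL by (simp add: ip_diff_left L2_diff ip_commute[of _ "dw s" ut])
    qed
  qed
  have "((\<lambda>s. ip \<Omega> (du s) (w t) + ip \<Omega> (dw s) (u t) + (s - t) * ip \<Omega> (du s) (dw s))
          \<longlongrightarrow> ip \<Omega> ut (w t) + ip \<Omega> wt (u t) + (t - t) * ip \<Omega> ut wt) ?F"
    by (intro tendsto_intros du1 dw1 rem)
  then have "((\<lambda>s. ip \<Omega> (du s) (w t) + ip \<Omega> (dw s) (u t) + (s - t) * ip \<Omega> (du s) (dw s))
          \<longlongrightarrow> ip \<Omega> ut (w t) + ip \<Omega> wt (u t)) ?F" by simp
  moreover have "\<forall>\<^sub>F s in ?F. ip \<Omega> (du s) (w t) + ip \<Omega> (dw s) (u t) + (s - t) * ip \<Omega> (du s) (dw s)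
      = (ip \<Omega> (u s) (w s) - ip \<Omega> (u t) (w t)) / (s - t)"
    using ev
  proof eventually_elim
    case (elim s)
    have us: "u s = (\<lambda>x. u t x + (s - t) *\<^sub>R du s x)" and ws: "w s = (\<lambda>x. w t x + (s - t) *\<^sub>R dw s x)"
      using elim by (auto simp: du_def dw_def)
    have L: "u t \<in> L2 \<Omega>" "w t \<in> L2 \<Omega>" "du s \<in> L2 \<Omega>" "dw s \<in> L2 \<Omega>"
      using elim u w t duL dwL by auto
    have left: "ip \<Omega> (u s) (w s) = ip \<Omega> (u t) (w s) + (s - t) * ip \<Omega> (du s) (w s)"
      using L w[of s] elim by (subst us) (simp add: ip_add_left L2_scaleR ip_scaleR_left)
    have right: "ip \<Omega> v (w s) = ip \<Omega> v (w t) + (s - t) * ip \<Omega> v (dw s)" if "v \<in> L2 \<Omega>" for v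
      using L that by (subst ws) (simp add: ip_add_right L2_scaleR ip_scaleR_right)
    have "ip \<Omega> (u s) (w s) - ip \<Omega> (u t) (w t)
        = (s - t) * (ip \<Omega> (du s) (w t) + ip \<Omega> (dw s) (u t) + (s - t) * ip \<Omega> (du s) (dw s))"
      unfolding left right[OF L(1)] right[OF L(3)] ip_commute[of _ "u t" "dw s"]
      by (simp add: algebra_simps)
    then show ?case using elim by simp
  qed
  ultimately show ?thesis
    unfolding has_field_derivative_iff by (rule Lim_transform_eventually)
qed

section \<open>Test functions\<close>

lemma pd_eqI: "(\<phi> has_derivative D) (at x) \<Longrightarrow> pd i \<phi> x = D (axis i 1)"
  by (simp add: pd_def flip: frechet_derivative_at)

lemma Ck_Suc_imp: "Ck (Suc k) \<phi> \<Longrightarrow> Ck k \<phi>"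
  by (induction k arbitrary: \<phi>)
    (auto simp: continuous_on_eq_continuous_at differentiable_imp_continuous_within)

lemma pd_const: "pd i (\<lambda>x. c) = (\<lambda>x. 0)"
  by (rule ext, subst pd_eqI[OF has_derivative_const]) simp

lemma Ck_const: "Ck k (\<lambda>x. c)"
  by (induction k arbitrary: c) (simp_all add: pd_const)

lemma pd_add:
  assumes "f differentiable (at x)" "g differentiable (at x)"
  shows "pd i (\<lambda>x. f x + g x) x = pd i f x + pd i g x"
  using assms unfolding frechet_derivative_works
  by (subst pd_eqI[OF has_derivative_add]) (assumption, assumption, simp add: pd_def)

lemma pd_mult:
  assumes "f differentiable (at x)" "g differentiable (at x)"
  shows "pd i (\<lambda>x. f x * g x) x = pd i f x * g x + f x * pd i g x"
  using assms unfolding frechet_derivative_works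
  by (subst pd_eqI[OF has_derivative_mult]) (assumption, assumption, simp add: pd_def)

lemma Ck_add: "Ck k f \<Longrightarrow> Ck k g \<Longrightarrow> Ck k (\<lambda>x. f x + g x)"
proof (induction k arbitrary: f g)
  case 0
  then show ?case by (simp add: continuous_intros)
next
  case (Suc k)
  moreover have "pd i (\<lambda>x. f x + g x) = (\<lambda>x. pd i f x + pd i g x)" for i
    using Suc.prems by (intro ext pd_add) simp_all
  ultimately show ?case by simp
qed

text \<open>The Leibniz rule leaves one factor undifferentiated in each term;
  \<open>Ck_Suc_imp\<close> lowers its order so that the induction hypothesis applies.\<close>

lemma Ck_mult: "Ck k f \<Longrightarrow> Ck k g \<Longrightarrow> Ck k (\<lambda>x. f x * g x)"
proof (induction k arbitrary: f g)
  case 0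
  then show ?case by (simp add: continuous_intros)
next
  case (Suc k)
  have "pd i (\<lambda>x. f x * g x) = (\<lambda>x. pd i f x * g x + f x * pd i g x)" for i
    using Suc.prems by (intro ext pd_mult) simp_all
  moreover have "Ck k (\<lambda>x. pd i f x * g x + f x * pd i g x)" for i
    using Suc.prems Suc.prems[THEN Ck_Suc_imp] by (intro Ck_add Suc.IH) simp_all
  ultimately show ?case using Suc.prems by simp
qed

lemma Ck_prod: "(\<And>j. j \<in> A \<Longrightarrow> Ck k (f j)) \<Longrightarrow> Ck k (\<lambda>x. \<Prod>j\<in>A. f j x)"
  by (induction A rule: infinite_finite_induct) (auto simp: Ck_const Ck_mult simp del: Ck.simps)

text \<open>Up to linear combinations, this family is closed under differentiation, and every member
  is smooth because all of them vanish to infinite order at \<open>0\<close>.\<close>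

definition flat :: "nat \<Rightarrow> real \<Rightarrow> real" where
  "flat n x = (if 0 < x then inverse x ^ n * exp (- inverse x) else 0)"

text \<open>Substituting the reciprocal of \<open>x\<close> turns this into the decay of a power
  divided by the exponential at infinity.\<close>

lemma flat_right_limit: "(flat n \<longlongrightarrow> 0) (at_right 0)"
proof -
  have "((\<lambda>x. inverse x ^ n / exp (inverse x)) \<longlongrightarrow> (0::real)) (at_right 0)"
    by (rule filterlim_compose[OF tendsto_power_div_exp_0 filterlim_inverse_at_top_right])
  moreover have "\<forall>\<^sub>F x in at_right 0. inverse x ^ n / exp (inverse x) = flat n (x::real)"
    by (auto simp: eventually_at_filter flat_def exp_minus divide_inverse)
  ultimately show ?thesis by (rule Lim_transform_eventually)
qed

text \<open>Away from 0 the defining formula is differentiated. At 0 the quotient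
  \<open>flat n h / h\<close> is 0 on the left and \<open>flat (Suc n) h\<close> on the right, so
  both one-sided limits are 0.\<close>

lemma flat_has_derivative:
  "(flat n has_real_derivative (flat (n + 2) x - real n * flat (n + 1) x)) (at x)"
proof -
  consider "x < 0" | "x = 0" | "0 < x" by linarith
  then show ?thesis
  proof cases
    case 1
    have "(flat n has_real_derivative 0) (at x)"
      by (rule has_field_derivative_transform_within_open[where f = "\<lambda>x. 0" and S = "{..<0}"])
        (use 1 in \<open>auto simp: flat_def\<close>)
    then show ?thesis using 1 by (simp add: flat_def)
  next
    case 2
    have "((\<lambda>h. flat n h / h) \<longlongrightarrow> 0) (at 0)"
      unfolding filterlim_at_split
    proof
      show "((\<lambda>h. flat n h / h) \<longlongrightarrow> 0) (at_left 0)"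
        by (rule Lim_transform_eventually[OF tendsto_const])
          (auto simp: eventually_at_filter flat_def)
      show "((\<lambda>h. flat n h / h) \<longlongrightarrow> 0) (at_right 0)"
        by (rule Lim_transform_eventually[OF flat_right_limit[of "Suc n"]])
          (auto simp: eventually_at_filter flat_def divide_inverse)
    qed
    then show ?thesis
      using 2 by (simp add: has_field_derivative_iff flat_def)
  next
    case 3
    have D: "((\<lambda>x. inverse x ^ n * exp (- inverse x)) has_real_derivative
        (real n * inverse x ^ (n - 1) * (- (inverse x ^ 2))) * exp (- inverse x)
        + inverse x ^ n * (exp (- inverse x) * inverse x ^ 2)) (at x)"
      using 3 by (auto intro!: derivative_eq_intros simp: power2_eq_square)
    \<comment> \<open>The case \<open>n = 0\<close> is separate because \<open>n - 1\<close>
      truncates to 0 there; the factor \<open>real n\<close> makes both sides vanish.\<close>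
    have eq: "real n * inverse x ^ (n - 1) * (- (inverse x ^ 2)) = - (real n * inverse x ^ (n + 1))"
      by (cases n) (simp_all add: power2_eq_square)
    have "((\<lambda>x. inverse x ^ n * exp (- inverse x)) has_real_derivative
        (flat (n + 2) x - real n * flat (n + 1) x)) (at x)"
      using D[unfolded eq] 3 by (simp add: flat_def power_add power2_eq_square algebra_simps)
    then show ?thesis
      by (rule has_field_derivative_transform_within_open[where S = "{0<..}"])
        (use 3 in \<open>auto simp: flat_def\<close>)
  qed
qed

lemma flat_component_has_derivative:
  "((\<lambda>x. flat n (\<alpha> * x $ j + \<beta>)) has_derivative
    (\<lambda>h. (flat (n + 2) (\<alpha> * x $ j + \<beta>) - real n * flat (n + 1) (\<alpha> * x $ j + \<beta>)) * (\<alpha> * h $ j))) (at x)"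
proof -
  have "((\<lambda>x. \<alpha> * x $ j + \<beta>) has_derivative (\<lambda>h. \<alpha> * h $ j)) (at x)"
    by (auto intro!: derivative_eq_intros bounded_linear_imp_has_derivative bounded_linear_vec_nth)
  from has_derivative_compose[OF this flat_has_derivative[of n, unfolded has_field_derivative_def]]
  show ?thesis by simp
qed

text \<open>A partial derivative only raises the index of \<open>flat\<close> and multiplies by
  constants, so induction on \<open>k\<close> for all \<open>n\<close> at once closes. The affine
  argument covers both rising and falling profiles.\<close>

lemma Ck_flat: "Ck k (\<lambda>x. flat n (\<alpha> * x $ j + \<beta>))"
proof (induction k arbitrary: n)
  case 0
  show ?case
    by (auto simp: continuous_on_eq_continuous_at intro: has_derivative_continuous flat_component_has_derivative)
next
  case (Suc k)
  have "pd i (\<lambda>x. flat n (\<alpha> * x $ j + \<beta>)) = (\<lambda>x. flat (n + 2) (\<alpha> * x $ j + \<beta>) * (\<alpha> * axis i 1 $ j)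
      + flat (n + 1) (\<alpha> * x $ j + \<beta>) * (- real n * (\<alpha> * axis i 1 $ j)))" for i
    by (rule ext, subst pd_eqI[OF flat_component_has_derivative]) (simp add: algebra_simps)
  moreover have "Ck k (\<lambda>x. flat (n + 2) (\<alpha> * x $ j + \<beta>) * (\<alpha> * axis i 1 $ j)
      + flat (n + 1) (\<alpha> * x $ j + \<beta>) * (- real n * (\<alpha> * axis i 1 $ j)))" for i
    by (intro Ck_add Ck_mult Suc.IH Ck_const)
  moreover have "(\<lambda>x. flat n (\<alpha> * x $ j + \<beta>)) differentiable (at x)" for x
    using flat_component_has_derivative by (rule differentiableI)
  ultimately show ?case by simp
qed

lemma flat_0_nonneg: "0 \<le> flat 0 x" and flat_0_le_1: "flat 0 x \<le> 1"
  by (auto simp: flat_def)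

text \<open>Steepening the profile yields the step function: the exponent tends to 0 for positive
  \<open>x\<close>, while every member is 0 for the other \<open>x\<close>. \<open>Suc m\<close>
  keeps the slope positive.\<close>

lemma flat_0_limit: "(\<lambda>m. flat 0 (real (Suc m) * x)) \<longlonglongrightarrow> (if 0 < x then 1 else 0)"
proof (cases "0 < x")
  case True
  have "(\<lambda>m. exp (- (inverse (real (Suc m)) * inverse x))) \<longlonglongrightarrow> exp (- (0 * inverse x))"
    by (intro tendsto_intros LIMSEQ_inverse_real_of_nat)
  with True show ?thesis by (simp add: flat_def)
next
  case False
  then have "flat 0 (real (Suc m) * x) = 0" for m
    using mult_nonneg_nonpos[of "real (Suc m)" x] by (simp add: flat_def not_less del: of_nat_Suc)
  with False show ?thesis by simp
qed

text \<open>Smooth approximations to the indicator of the open box. In each coordinate one factor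
  switches on past \<open>a\<close> and the other switches off before \<open>b\<close>, ever more
  steeply as \<open>m\<close> grows.\<close>

definition bump :: "nat \<Rightarrow> real ^ 'd \<Rightarrow> real ^ 'd \<Rightarrow> real ^ 'd \<Rightarrow> real" where
  "bump m a b x = (\<Prod>j\<in>UNIV. flat 0 (real (Suc m) * (x $ j - a $ j)) * flat 0 (real (Suc m) * (b $ j - x $ j)))"

lemma Ck_bump: "Ck k (bump m a b)"
proof -
  have "bump m a b = (\<lambda>x. \<Prod>j\<in>UNIV. flat 0 (real (Suc m) * x $ j + - (real (Suc m) * a $ j))
      * flat 0 ((- real (Suc m)) * x $ j + real (Suc m) * b $ j))"
    by (rule ext) (simp add: bump_def algebra_simps)
  then show ?thesis by (simp only:) (intro Ck_prod Ck_mult Ck_flat)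
qed

lemma bump_nonneg: "0 \<le> bump m a b x" and bump_le_1: "bump m a b x \<le> 1"
  unfolding bump_def
  by (auto intro!: prod_nonneg prod_le_1 mult_nonneg_nonneg mult_le_one flat_0_nonneg flat_0_le_1)

lemma bump_outside: "x \<notin> box a b \<Longrightarrow> bump m a b x = 0"
proof -
  assume "x \<notin> box a b"
  then obtain j where "x $ j - a $ j \<le> 0 \<or> b $ j - x $ j \<le> 0"
    by (auto simp: mem_box_cart not_less)
  then have "flat 0 (real (Suc m) * (x $ j - a $ j)) * flat 0 (real (Suc m) * (b $ j - x $ j)) = 0"
    by (auto simp: flat_def zero_less_mult_iff)
  then show ?thesis unfolding bump_def by (intro prod_zero) auto
qed

lemma bump_limit: "(\<lambda>m. bump m a b x) \<longlonglongrightarrow> indicator (box a b) x"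
proof -
  have "(\<lambda>m. bump m a b x) \<longlonglongrightarrow>
      (\<Prod>j\<in>UNIV. (if 0 < x $ j - a $ j then 1 else 0) * (if 0 < b $ j - x $ j then 1 else 0))"
    unfolding bump_def by (intro tendsto_intros flat_0_limit)
  moreover have "(\<Prod>j\<in>UNIV. (if 0 < x $ j - a $ j then 1 else 0) * (if 0 < b $ j - x $ j then 1 else 0))
      = (indicator (box a b) x :: real)"
    by (auto simp: indicator_def mem_box_cart intro!: prod_zero)
  ultimately show ?thesis by simp
qed

text \<open>The closed box is a compact set containing the support, hence the assumption on
  \<open>cbox\<close> instead of \<open>box\<close>.\<close>

lemma bump_test_function:
  assumes "cbox a b \<subseteq> U"
  shows "bump m a b \<in> test_functions U"
proof -
  have sub: "closure {x. bump m a b x \<noteq> 0} \<subseteq> cbox a b"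
    using bump_outside[of _ a b m] box_subset_cbox[of a b] by (intro closure_minimal) auto
  then have "compact (closure {x. bump m a b x \<noteq> 0})"
    by (metis bounded_cbox bounded_subset closed_closure compact_eq_bounded_closed)
  with sub assms show ?thesis by (auto simp: test_functions_def Ck_bump)
qed

section \<open>Closure properties and bounds of test functions\<close>

lemma test_function_support: "\<phi> \<in> test_functions U \<Longrightarrow> x \<notin> U \<Longrightarrow> \<phi> x = 0"
  using closure_subset[of "{x. \<phi> x \<noteq> 0}"] by (auto simp: test_functions_def)

lemma test_functions_mono: "U \<subseteq> \<Omega> \<Longrightarrow> test_functions U \<subseteq> test_functions \<Omega>"
  by (auto simp: test_functions_def)

lemma test_function_has_derivative:
  "\<phi> \<in> test_functions U \<Longrightarrow> (\<phi> has_derivative frechet_derivative \<phi> (at x)) (at x)"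
  unfolding test_functions_def frechet_derivative_works[symmetric]
  by (metis (mono_tags, lifting) Ck.simps(2) mem_Collect_eq)

lemma test_function_continuous: "\<phi> \<in> test_functions U \<Longrightarrow> continuous_on A \<phi>"
  unfolding test_functions_def by (metis (mono_tags, lifting) Ck.simps(1) continuous_on_subset mem_Collect_eq subset_UNIV)

text \<open>A closed subset of a compact support is compact; thus derivatives and products of test
  functions inherit their support condition.\<close>

lemma test_functionI:
  assumes "\<And>k. Ck k \<psi>" and "\<phi> \<in> test_functions U" and "{x. \<psi> x \<noteq> 0} \<subseteq> closure {x. \<phi> x \<noteq> 0}"
  shows "\<psi> \<in> test_functions U"
proof -
  have sub: "closure {x. \<psi> x \<noteq> 0} \<subseteq> closure {x. \<phi> x \<noteq> 0}"
    using assms(3) by (rule closure_minimal) simp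
  then have "compact (closure {x. \<psi> x \<noteq> 0})"
    using assms(2) bounded_subset[OF _ sub] by (auto simp: test_functions_def compact_eq_bounded_closed)
  then show ?thesis using assms sub by (auto simp: test_functions_def)
qed

text \<open>Off its closed support the function is locally zero, so its derivative vanishes there
  too.\<close>

lemma test_function_pd:
  assumes \<phi>: "\<phi> \<in> test_functions U"
  shows "pd i \<phi> \<in> test_functions U"
proof (rule test_functionI[OF _ \<phi>])
  show "Ck k (pd i \<phi>)" for k
    using \<phi> by (auto simp: test_functions_def dest: spec[of _ "Suc k"])
  show "{x. pd i \<phi> x \<noteq> 0} \<subseteq> closure {x. \<phi> x \<noteq> 0}"
  proof (rule subsetI, rule ccontr)
    fix x assume x: "x \<in> {x. pd i \<phi> x \<noteq> 0}" "x \<notin> closure {x. \<phi> x \<noteq> 0}"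
    have "(\<phi> has_derivative (\<lambda>h. 0)) (at x)"
      by (rule has_derivative_transform_within_open[where f = "\<lambda>x. 0" and s = "- closure {x. \<phi> x \<noteq> 0}"])
        (use x closure_subset[of "{x. \<phi> x \<noteq> 0}"] in auto)
    then have "pd i \<phi> x = 0" by (simp add: pd_eqI)
    with x show False by simp
  qed
qed

lemma test_function_mult:
  assumes "\<phi> \<in> test_functions U" "\<psi> \<in> test_functions V"
  shows "(\<lambda>x. \<phi> x * \<psi> x) \<in> test_functions U"
  by (rule test_functionI[OF _ assms(1)])
    (use assms closure_subset[of "{x. \<phi> x \<noteq> 0}"] in \<open>auto simp: test_functions_def intro!: Ck_mult\<close>)

lemma pd_test_function_mult:
  assumes "\<phi> \<in> test_functions U" "\<psi> \<in> test_functions V"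
  shows "pd i (\<lambda>x. \<phi> x * \<psi> x) x = pd i \<phi> x * \<psi> x + \<phi> x * pd i \<psi> x"
  using assms[THEN test_function_has_derivative] by (intro pd_mult differentiableI)

lemma test_function_bounded:
  assumes "\<phi> \<in> test_functions U"
  obtains M where "0 \<le> M" "\<And>x. \<bar>\<phi> x\<bar> \<le> M"
proof -
  let ?K = "closure {x. \<phi> x \<noteq> 0}"
  have "compact (\<phi> ` ?K)"
    using assms by (intro compact_continuous_image test_function_continuous) (auto simp: test_functions_def)
  then have "bounded (\<phi> ` ?K)" by (rule compact_imp_bounded)
  then obtain M where "0 < M" and "\<forall>y\<in>\<phi> ` ?K. norm y \<le> M" unfolding bounded_pos by blast
  then have M: "0 < M" "\<And>x. x \<in> ?K \<Longrightarrow> \<bar>\<phi> x\<bar> \<le> M" by auto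
  have "\<bar>\<phi> x\<bar> \<le> M" for x
    using M closure_subset[of "{x. \<phi> x \<noteq> 0}"] by (cases "\<phi> x = 0") auto
  with M(1) show ?thesis by (intro that[of M]) auto
qed

lemma integrable_test_function:
  assumes "\<phi> \<in> test_functions U"
  shows "integrable lborel \<phi>"
proof -
  let ?K = "closure {x. \<phi> x \<noteq> 0}"
  have "integrable lborel (\<lambda>x. indicator ?K x *\<^sub>R \<phi> x)"
    using assms by (intro borel_integrable_compact test_function_continuous) (auto simp: test_functions_def)
  moreover have "(\<lambda>x. indicator ?K x *\<^sub>R \<phi> x) = \<phi>"
    using closure_subset[of "{x. \<phi> x \<noteq> 0}"] by (auto simp: indicator_def fun_eq_iff)
  ultimately show ?thesis by simp
qed

section \<open>Measurability and integrals of test functions\<close>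

lemma test_function_borel: "\<phi> \<in> test_functions U \<Longrightarrow> \<phi> \<in> borel_measurable borel"
  by (intro borel_measurable_continuous_onI test_function_continuous)

lemma borel_measurable_lebesgue_on: "f \<in> borel_measurable borel \<Longrightarrow> f \<in> borel_measurable (lebesgue_on A)"
  by (simp add: measurable_completion measurable_restrict_space1)

lemma integrable_lebesgue_on:
  fixes f :: "'a::euclidean_space \<Rightarrow> real"
  assumes "integrable lborel f" and "A \<in> sets lebesgue"
  shows "integrable (lebesgue_on A) f"
proof -
  have "integrable lebesgue f"
    using assms(1) by (simp add: integrable_completion)
  then show ?thesis
    using integrable_mult_indicator[of A lebesgue f] assms(2) by (simp add: integrable_restrict_space)
qed

lemma test_function_L2:
  assumes \<phi>: "\<phi> \<in> test_functions U" and "\<Omega> \<in> sets lebesgue"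
  shows "\<phi> \<in> L2 \<Omega>"
  using integrable_lebesgue_on[OF integrable_test_function[OF test_function_mult[OF \<phi> \<phi>]] assms(2)]
    borel_measurable_lebesgue_on[OF test_function_borel[OF \<phi>]]
  by (simp add: L2_def power2_eq_square)

text \<open>Difference quotients in direction \<open>e\<close> have integral 0 by translation
  invariance, and they converge dominatedly to the partial derivative. This avoids iterated
  integrals.\<close>

lemma integral_pd_test_function:
  assumes \<phi>: "\<phi> \<in> test_functions U"
  shows "integral\<^sup>L lborel (pd i \<phi>) = 0"
proof -
  define e :: "real ^ 'a" where "e = axis i 1"
  define h where "h n = inverse (real (Suc n))" for n
  define D where "D n = (\<lambda>x. (\<phi> (h n *\<^sub>R e + x) - \<phi> x) / h n)" for n
  have h: "0 < h n" "h n \<le> 1" for n by (auto simp: h_def inverse_le_1_iff)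
  have h0: "h \<longlonglongrightarrow> 0" unfolding h_def by (rule LIMSEQ_inverse_real_of_nat)
  have deriv: "((\<lambda>t. \<phi> (t *\<^sub>R e + x)) has_real_derivative pd i \<phi> (t *\<^sub>R e + x)) (at t)" for t x
  proof -
    have "((\<lambda>t. t *\<^sub>R e + x) has_derivative (\<lambda>s. s *\<^sub>R e)) (at t)"
      by (auto intro!: derivative_eq_intros)
    from has_derivative_compose[OF this test_function_has_derivative[OF \<phi>]]
    have "((\<lambda>t. \<phi> (t *\<^sub>R e + x)) has_derivative (\<lambda>s. s * pd i \<phi> (t *\<^sub>R e + x))) (at t)"
      using linear_frechet_derivative[OF differentiableI[OF test_function_has_derivative[OF \<phi>]]]
      by (simp add: pd_def e_def linear_scale)
    then show ?thesis by (simp add: has_field_derivative_def mult_commute_abs)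
  qed
  have lim: "(\<lambda>n. D n x) \<longlonglongrightarrow> pd i \<phi> x" for x
  proof -
    have "((\<lambda>t. (\<phi> (t *\<^sub>R e + x) - \<phi> x) / t) \<longlongrightarrow> pd i \<phi> x) (at 0)"
      using deriv[of x 0] by (simp add: has_field_derivative_iff)
    moreover have "filterlim h (at 0) sequentially"
      using h0 h(1) by (auto simp: filterlim_at intro!: always_eventually less_imp_neq[symmetric])
    ultimately show ?thesis unfolding D_def by (rule filterlim_compose)
  qed
  obtain M where M: "0 \<le> M" "\<And>x. \<bar>pd i \<phi> x\<bar> \<le> M"
    using test_function_bounded[OF test_function_pd[OF \<phi>, of i]] by blast
  \<comment> \<open>The mean value theorem turns each quotient into a value of the bounded partial
    derivative.\<close>
  have bound: "\<bar>D n x\<bar> \<le> M" for n x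
  proof -
    obtain z where "\<phi> (h n *\<^sub>R e + x) - \<phi> (0 *\<^sub>R e + x) = (h n - 0) * pd i \<phi> (z *\<^sub>R e + x)"
      using MVT2[OF h(1) deriv] by blast
    then have "D n x = pd i \<phi> (z *\<^sub>R e + x)" using h(1)[of n] by (simp add: D_def)
    then show ?thesis using M(2) by simp
  qed
  have "bounded (closure {x. \<phi> x \<noteq> 0})"
    using \<phi> by (auto simp: test_functions_def compact_imp_bounded)
  then obtain R where R: "\<And>x. \<phi> x \<noteq> 0 \<Longrightarrow> norm x \<le> R"
    using closure_subset[of "{x. \<phi> x \<noteq> 0}"] unfolding bounded_iff by blast
  \<comment> \<open>Steps have length at most 1, so all quotients live in one ball whose radius
    exceeds that of the support by 1.\<close>
  have supp: "x \<in> cball 0 (R + 1)" if "D n x \<noteq> 0" for n x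
  proof -
    have "norm (h n *\<^sub>R e + x) \<le> R \<or> norm x \<le> R"
      using that R[of x] R[of "h n *\<^sub>R e + x"] by (cases "\<phi> x = 0") (auto simp: D_def)
    moreover have "norm x \<le> norm (h n *\<^sub>R e + x) + norm (h n *\<^sub>R e)"
      by (metis add_diff_cancel_left' norm_triangle_ineq4)
    moreover have "norm (h n *\<^sub>R e) \<le> 1" using h[of n] by (simp add: e_def)
    ultimately show ?thesis by auto
  qed
  have meas: "(\<lambda>x. \<phi> (c + x)) \<in> borel_measurable borel" for c
    by (intro borel_measurable_continuous_onI continuous_on_compose2[OF test_function_continuous[OF \<phi>], of UNIV]
        continuous_intros) auto
  have shift: "integrable lborel (\<lambda>x. \<phi> (c + x))" "(LINT x|lborel. \<phi> (c + x)) = integral\<^sup>L lborel \<phi>" for c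
  proof -
    have d: "distr lborel lborel ((+) c) = (lborel :: (real ^ 'a) measure)"
      using lborel_distr_plus[of c] by (simp cong: distr_cong)
    show "integrable lborel (\<lambda>x. \<phi> (c + x))"
      by (rule integrable_distr[of "(+) c" lborel lborel]) (simp_all add: d integrable_test_function[OF \<phi>])
    show "(LINT x|lborel. \<phi> (c + x)) = integral\<^sup>L lborel \<phi>"
      using integral_distr[of "(+) c" lborel lborel \<phi>] test_function_borel[OF \<phi>] by (simp add: d)
  qed
  have "(\<lambda>n. integral\<^sup>L lborel (D n)) \<longlonglongrightarrow> integral\<^sup>L lborel (pd i \<phi>)"
  proof (rule integral_dominated_convergence[where w = "\<lambda>x. indicator (cball 0 (R + 1)) x *\<^sub>R M"])
    show "pd i \<phi> \<in> borel_measurable lborel"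
      using test_function_borel[OF test_function_pd[OF \<phi>]] by simp
    show "D n \<in> borel_measurable lborel" for n
      unfolding D_def using meas[of "h n *\<^sub>R e"] test_function_borel[OF \<phi>] by simp
    show "integrable lborel (\<lambda>x::real^'a. indicator (cball 0 (R + 1)) x *\<^sub>R M)"
      by (intro borel_integrable_compact) auto
    show "AE x in lborel. norm (D n x) \<le> indicator (cball 0 (R + 1)) x *\<^sub>R M" for n
      using bound supp by (intro AE_I2) (auto simp: indicator_def)
  qed (use lim in simp)
  moreover have "integral\<^sup>L lborel (D n) = 0" for n
    using shift integrable_test_function[OF \<phi>] by (simp add: D_def)
  ultimately show ?thesis by (simp add: LIMSEQ_const_iff)
qed

section \<open>The fundamental lemma of the calculus of variations\<close>

lemma box_Int_box_cart:
  fixes a b c d :: "real ^ 'n"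
  shows "box c d \<inter> box a b = box (\<chi> i. max (c $ i) (a $ i)) (\<chi> i. min (d $ i) (b $ i))"
  by (auto simp: mem_box_cart)

text \<open>Boxes form an intersection-stable generator of the Borel sets, so the vanishing of
  integrals spreads to all Borel sets; a function whose integrals all vanish is zero almost
  everywhere.\<close>

lemma AE_zero_if_box_integrals_zero:
  fixes f :: "real ^ 'n \<Rightarrow> real"
  assumes f: "integrable lebesgue f"
    and zero: "\<And>a b. (LINT x|lebesgue. indicator (box a b) x * f x) = 0"
    and total: "integral\<^sup>L lebesgue f = 0"
  shows "AE x in lebesgue. f x = 0"
proof -
  \<comment> \<open>Lebesgue measure is a completion: the argument runs on Borel sets with a Borel
    representative of \<open>f\<close>.\<close>
  obtain f' where f': "f' \<in> borel_measurable lborel" and ae: "AE x in lborel. f x = f' x"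
    using completion_ex_borel_measurable_real[of f lborel] f by auto
  have aeL: "AE x in lebesgue. f x = f' x" using ae by (rule AE_completion)
  have f'L: "f' \<in> borel_measurable lebesgue" using f' by (rule measurable_completion)
  have "integrable lebesgue f'"
    using integrable_cong_AE[THEN iffD1, OF _ f'L aeL f] f by auto
  then have int: "integrable lborel f'" using f' by (simp add: integrable_completion)
  have eq: "set_lebesgue_integral lborel A f' = (LINT x|lebesgue. indicator A x * f x)"
    if "A \<in> sets borel" for A
  proof -
    have m: "(\<lambda>x. indicator A x * f' x) \<in> borel_measurable lborel" using that f' by simp
    have "set_lebesgue_integral lborel A f' = (LINT x|lebesgue. indicator A x * f' x)"
      using integral_completion[OF m] by (simp add: set_lebesgue_integral_def)
    also have "\<dots> = (LINT x|lebesgue. indicator A x * f x)"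
    proof (rule integral_cong_AE)
      show "(\<lambda>x. indicator A x * f' x) \<in> borel_measurable lebesgue" using m by (rule measurable_completion)
      show "(\<lambda>x. indicator A x * f x) \<in> borel_measurable lebesgue"
        using that f by (intro borel_measurable_times borel_measurable_indicator) auto
      show "AE x in lebesgue. indicator A x * f' x = indicator A x * f x"
        using aeL by eventually_elim simp
    qed
    finally show ?thesis .
  qed
  have "set_lebesgue_integral lborel A f' = 0" if A: "A \<in> sets lborel" for A
  proof -
    have "Int_stable (range (\<lambda>(a, b). box a b :: (real ^ 'n) set))"
      by (rule Int_stableI) (auto simp: box_Int_box_cart intro!: pair_imageI)
    moreover have "range (\<lambda>(a, b). box a b :: (real ^ 'n) set) \<subseteq> Pow UNIV"
      by simp
    moreover have "A \<in> sigma_sets UNIV (range (\<lambda>(a, b). box a b :: (real ^ 'n) set))"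
      using A by (simp add: borel_eq_box)
    ultimately show ?thesis
    proof (induction rule: sigma_sets_induct_disjoint)
      case (basic A)
      then show ?case using zero by (auto simp: eq)
    next
      case empty
      show ?case by (simp add: set_lebesgue_integral_def)
    next
      \<comment> \<open>The whole space is not a box, so its integral comes from
        \<open>total\<close>; additivity then gives the complement.\<close>
      case (compl A)
      then have A: "A \<in> sets lborel" by (simp add: borel_eq_box)
      have sA: "set_integrable lborel B f'" if "B \<in> sets lborel" for B
        using integrable_mult_indicator[OF that int] by (simp add: set_integrable_def)
      have "set_lebesgue_integral lborel (A \<union> (UNIV - A)) f'
          = set_lebesgue_integral lborel A f' + set_lebesgue_integral lborel (UNIV - A) f'"
        using A sA by (intro set_integral_Un) auto
      moreover have "set_lebesgue_integral lborel UNIV f' = 0" using total by (simp add: eq)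
      ultimately show ?case using compl by simp
    next
      case (union A)
      then have A: "A i \<in> sets lborel" for i by (auto simp: borel_eq_box)
      have "set_integrable lborel (\<Union>i. A i) f'"
        unfolding set_integrable_def using A by (intro integrable_mult_indicator int) auto
      then have "set_lebesgue_integral lborel (\<Union>i. A i) f' = (\<Sum>i. set_lebesgue_integral lborel (A i) f')"
        using A union(1) by (intro lebesgue_integral_countable_add) (auto simp: disjoint_family_on_def)
      then show ?case using union by simp
    qed
  qed
  then have "AE x in lborel. f' x = 0" by (rule sigma_finite_measure.density_zero[OF sigma_finite_lborel int])
  with ae have "AE x in lborel. f x = 0" by eventually_elim simp
  then show ?thesis by (rule AE_completion)
qed

text \<open>Bumps carry the hypothesis over to indicators of boxes inside \<open>U\<close>. Hence
  \<open>g\<close> vanishes almost everywhere on each such box, and countably many of them cover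
  \<open>U\<close>.\<close>

lemma fundamental_lemma:
  assumes \<Omega>: "\<Omega> \<in> sets lebesgue" and U: "open U" "U \<subseteq> \<Omega>" and g: "g \<in> L2 \<Omega>"
    and zero: "\<And>\<phi>. \<phi> \<in> test_functions U \<Longrightarrow> ip \<Omega> g \<phi> = 0"
  shows "AE x in lebesgue. x \<in> U \<longrightarrow> g x = 0"
proof -
  \<comment> \<open>On a bounded box the indicator is itself in \<open>L2\<close>, so
    \<open>g\<close> is integrable there; this is the dominating function for the bumps.\<close>
  have gb: "integrable (lebesgue_on \<Omega>) (\<lambda>x. indicator (cbox a b) x * g x)" for a b
  proof -
    have "integrable lborel (\<lambda>x. (indicator (cbox a b) x :: real))"
      by (intro integrable_real_indicator emeasure_lborel_cbox_finite) simp
    from integrable_lebesgue_on[OF this \<Omega>] have "indicat_real (cbox a b) \<in> L2 \<Omega>"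
      by (auto simp: L2_def power2_eq_square simp flip: indicator_inter_arith
          intro!: borel_measurable_lebesgue_on)
    from integrable_inner_L2[OF this g] show ?thesis by simp
  qed
  have box0: "(LINT x|lebesgue_on \<Omega>. indicator (box a b) x * g x) = 0" if ab: "cbox a b \<subseteq> U" for a b
  proof -
    have "(\<lambda>m. LINT x|lebesgue_on \<Omega>. g x * bump m a b x) \<longlonglongrightarrow> (LINT x|lebesgue_on \<Omega>. indicator (box a b) x * g x)"
    proof (rule integral_dominated_convergence[where w = "\<lambda>x. \<bar>indicator (cbox a b) x * g x\<bar>"])
      show "(\<lambda>x. indicator (box a b) x * g x) \<in> borel_measurable (lebesgue_on \<Omega>)"
        using g by (intro borel_measurable_times borel_measurable_lebesgue_on L2_measurable) auto
      show "(\<lambda>x. g x * bump m a b x) \<in> borel_measurable (lebesgue_on \<Omega>)" for m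
        using g test_function_borel[OF bump_test_function[OF ab]]
        by (intro borel_measurable_times borel_measurable_lebesgue_on L2_measurable) auto
      show "integrable (lebesgue_on \<Omega>) (\<lambda>x. \<bar>indicator (cbox a b) x * g x\<bar>)"
        using gb by (rule integrable_abs)
      show "AE x in lebesgue_on \<Omega>. (\<lambda>m. g x * bump m a b x) \<longlonglongrightarrow> indicator (box a b) x * g x"
        using tendsto_mult[OF tendsto_const bump_limit] by (intro AE_I2) (subst mult.commute[of "indicator _ _"])
      show "AE x in lebesgue_on \<Omega>. norm (g x * bump m a b x) \<le> \<bar>indicator (cbox a b) x * g x\<bar>" for m
      proof (rule AE_I2)
        fix x
        have "\<bar>bump m a b x\<bar> \<le> indicator (cbox a b) x"
          using bump_outside[of x a b m] bump_nonneg[of m a b x] bump_le_1[of m a b x] box_subset_cbox[of a b]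
          by (auto simp: indicator_def)
        then show "norm (g x * bump m a b x) \<le> \<bar>indicator (cbox a b) x * g x\<bar>"
          by (simp add: abs_mult mult.commute[of "indicator _ _"] mult_left_mono)
      qed
    qed
    moreover have "(LINT x|lebesgue_on \<Omega>. g x * bump m a b x) = 0" for m
      using zero[OF bump_test_function[OF ab]] by (simp add: ip_def)
    ultimately show ?thesis by (simp add: LIMSEQ_const_iff)
  qed
  have ae_box: "AE x in lebesgue. x \<in> box a b \<longrightarrow> g x = 0" if ab: "cbox a b \<subseteq> U" for a b
  proof -
    let ?f = "\<lambda>x. indicator (box a b) x * g x"
    \<comment> \<open>A function supported in the box has the same integral over \<Omega> and over
      the whole space, where the box criterion is stated.\<close>
    have ext: "(LINT x|lebesgue. h x) = (LINT x|lebesgue_on \<Omega>. h x)" if "\<And>x. x \<notin> box a b \<Longrightarrow> h x = 0" for h :: "_ \<Rightarrow> real"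
    proof -
      have "(\<lambda>x. indicator \<Omega> x *\<^sub>R h x) = h"
      proof
        fix x show "indicator \<Omega> x *\<^sub>R h x = h x"
          using that[of x] ab U box_subset_cbox[of a b] by (cases "x \<in> box a b") (auto simp: indicator_def)
      qed
      then show ?thesis using \<Omega> by (simp add: integral_restrict_space)
    qed
    have "AE x in lebesgue. ?f x = 0"
    proof (rule AE_zero_if_box_integrals_zero)
      have "box a b \<in> sets (lebesgue_on \<Omega>)"
        using ab U box_subset_cbox[of a b]
        by (auto simp: sets_restrict_space intro!: image_eqI[of _ _ "box a b"])
      from integrable_mult_indicator[OF this gb[of a b]]
      have "integrable (lebesgue_on \<Omega>) (\<lambda>x. indicator (box a b) x * (indicator (cbox a b) x * g x))"
        by simp
      moreover have "(\<lambda>x. indicator (box a b) x * (indicator (cbox a b) x * g x)) = ?f"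
        using box_subset_cbox[of a b] by (auto simp: indicator_def fun_eq_iff)
      ultimately have "integrable lebesgue (\<lambda>x. indicator \<Omega> x *\<^sub>R ?f x)"
        using \<Omega> by (simp add: integrable_restrict_space)
      moreover have "(\<lambda>x. indicator \<Omega> x *\<^sub>R ?f x) = ?f"
        using ab U box_subset_cbox[of a b] by (auto simp: indicator_def fun_eq_iff)
      ultimately show "integrable lebesgue ?f" by simp
      show "integral\<^sup>L lebesgue ?f = 0"
        using box0[OF ab] by (subst ext) auto
      fix c d
      let ?c = "\<chi> i. max (c $ i) (a $ i)" and ?d = "\<chi> i. min (d $ i) (b $ i)"
      have "(LINT x|lebesgue. indicator (box c d) x * ?f x) = (LINT x|lebesgue_on \<Omega>. indicator (box ?c ?d) x * g x)"
        by (subst ext) (auto simp: box_Int_box_cart[symmetric] indicator_inter_arith mult.assoc)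
      also have "\<dots> = 0"
      \<comment> \<open>For a nonempty open box the closure is the closed box, which therefore stays
        inside \<open>U\<close>. An empty box contributes 0.\<close>
      proof (cases "box ?c ?d = {}")
        case False
        have "box ?c ?d \<subseteq> box a b" by (auto simp: box_Int_box_cart[symmetric])
        then have "closure (box ?c ?d) \<subseteq> cbox a b"
          by (intro closure_minimal) (use box_subset_cbox[of a b] in auto)
        then have "cbox ?c ?d \<subseteq> U" using False ab by (simp add: closure_box)
        then show ?thesis by (rule box0)
      qed simp
      finally show "(LINT x|lebesgue. indicator (box c d) x * ?f x) = 0" .
    qed
    then show ?thesis by eventually_elim auto
  qed
  \<comment> \<open>The Lindelof property reduces the cover of \<open>U\<close> to countably many
    boxes, so the exceptional null sets can be combined.\<close>
  let ?F = "{B. \<exists>a b. B = box a b \<and> cbox a b \<subseteq> U}"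
  obtain F where F: "F \<subseteq> ?F" "countable F" "\<Union>F = \<Union>?F"
    by (rule Lindelof[of ?F]) auto
  have cover: "x \<in> \<Union>F" if x: "x \<in> U" for x
  proof -
    obtain a b where "x \<in> box a b" "cbox a b \<subseteq> U"
      by (rule open_contains_cbox[OF U(1) x])
    then show ?thesis unfolding F(3) by auto
  qed
  have "AE x in lebesgue. \<forall>B\<in>F. x \<in> B \<longrightarrow> g x = 0"
    using F(1) ae_box by (intro AE_ball_countable'[OF _ F(2)]) auto
  then show ?thesis by eventually_elim (use cover in blast)
qed

text \<open>Tested with \<phi> supported in \<open>U\<close>, the function may be replaced by the
  constant \<open>k\<close>, and the integral of a derivative of \<phi> is 0. The fundamental lemma
  then applies to \<open>g\<close>.\<close>

lemma weak_pd_eq_0_if_const: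
  assumes \<Omega>: "\<Omega> \<in> sets lebesgue" and U: "open U" "U \<subseteq> \<Omega>"
    and v: "v \<in> L2 \<Omega>" and g: "has_weak_pd \<Omega> i v g"
    and const: "AE x in lebesgue. x \<in> U \<longrightarrow> v x = k"
  shows "AE x in lebesgue. x \<in> U \<longrightarrow> g x = 0"
proof (rule fundamental_lemma[OF \<Omega> U])
  show "g \<in> L2 \<Omega>" using g by (simp add: has_weak_pd_def)
  fix \<phi> assume \<phi>: "\<phi> \<in> test_functions U"
  have p: "pd i \<phi> \<in> test_functions U" using \<phi> by (rule test_function_pd)
  have sp: "indicator \<Omega> x * pd i \<phi> x = pd i \<phi> x" for x
    using test_function_support[OF p, of x] U by (auto simp: indicator_def)
  have "ip \<Omega> v (pd i \<phi>) = ip \<Omega> (\<lambda>x. k) (pd i \<phi>)"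
  proof (rule ip_cong_AE)
    have "AE x in lebesgue. x \<in> \<Omega> \<longrightarrow> v x \<bullet> pd i \<phi> x = k \<bullet> pd i \<phi> x"
      using const
    proof eventually_elim
      case (elim x)
      then show ?case using test_function_support[OF p, of x] by (cases "x \<in> U") auto
    qed
    then show "AE x in lebesgue_on \<Omega>. v x \<bullet> pd i \<phi> x = k \<bullet> pd i \<phi> x"
      using \<Omega> by (simp add: AE_restrict_space_iff)
  qed (use v test_function_borel[OF p] in \<open>auto intro: L2_measurable borel_measurable_lebesgue_on\<close>)
  also have "\<dots> = k * (LINT x|lebesgue. indicator \<Omega> x *\<^sub>R pd i \<phi> x)"
    using \<Omega> by (simp add: ip_def integral_restrict_space)
  also have "\<dots> = k * (LINT x|lborel. pd i \<phi> x)"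
    using test_function_borel[OF p] by (simp add: sp integral_completion)
  also have "\<dots> = 0" using integral_pd_test_function[OF \<phi>] by simp
  finally show "ip \<Omega> g \<phi> = 0"
    using g \<phi> test_functions_mono[OF U(2)] by (auto simp: has_weak_pd_def)
qed

section \<open>Integration by parts for products\<close>

text \<open>A product of two \<open>L2\<close> functions need not be in \<open>L2\<close>; with one
  essentially bounded factor it is, and this makes the triple products integrable.\<close>

definition Linf :: "(real ^ 'd) set \<Rightarrow> (real ^ 'd \<Rightarrow> 'b::euclidean_space) set" where
  "Linf \<Omega> = {f. f \<in> borel_measurable (lebesgue_on \<Omega>) \<and> (\<exists>M. AE x in lebesgue_on \<Omega>. norm (f x) \<le> M)}"

lemma Linf_component: "f \<in> Linf \<Omega> \<Longrightarrow> (\<lambda>x. f x $ i) \<in> Linf \<Omega>"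
proof -
  assume f: "f \<in> Linf \<Omega>"
  then obtain M where "AE x in lebesgue_on \<Omega>. norm (f x) \<le> M" by (auto simp: Linf_def)
  then have "AE x in lebesgue_on \<Omega>. norm (f x $ i) \<le> M"
    by eventually_elim (rule order_trans[OF Finite_Cartesian_Product.norm_nth_le])
  with f show ?thesis by (auto simp: Linf_def borel_measurable_nth)
qed

lemma test_function_Linf: "\<phi> \<in> test_functions U \<Longrightarrow> \<phi> \<in> Linf \<Omega>"
  using test_function_bounded[of \<phi> U] borel_measurable_lebesgue_on[OF test_function_borel, of \<phi> U \<Omega>]
  unfolding Linf_def by (metis (mono_tags, lifting) AE_I2 mem_Collect_eq real_norm_def)

lemma L2_scaleR_Linf:
  fixes g :: "real ^ 'd \<Rightarrow> 'b::euclidean_space"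
  assumes "f \<in> L2 \<Omega>" "g \<in> Linf \<Omega>"
  shows "(\<lambda>x. f x *\<^sub>R g x) \<in> L2 \<Omega>"
proof -
  obtain M where M: "AE x in lebesgue_on \<Omega>. norm (g x) \<le> M" and g: "g \<in> borel_measurable (lebesgue_on \<Omega>)"
    using assms by (auto simp: Linf_def)
  show ?thesis
  proof (rule L2_bound[OF assms(1)])
    show "AE x in lebesgue_on \<Omega>. norm (f x *\<^sub>R g x) \<le> M * norm (f x)"
      using M by eventually_elim (simp add: mult.commute[of M] mult_left_mono)
    show "(\<lambda>x. f x *\<^sub>R g x) \<in> borel_measurable (lebesgue_on \<Omega>)"
      using g L2_measurable[OF assms(1)] by measurable
  qed
qed

lemma L2_mult: "f \<in> L2 \<Omega> \<Longrightarrow> g \<in> Linf \<Omega> \<Longrightarrow> (\<lambda>x. f x * g x :: real) \<in> L2 \<Omega>"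
  using L2_scaleR_Linf[of f \<Omega> g] by simp

lemma ip_vec:
  fixes f g :: "real ^ 'd \<Rightarrow> 'b::euclidean_space ^ 'n"
  assumes "f \<in> L2 \<Omega>" "g \<in> L2 \<Omega>"
  shows "ip \<Omega> f g = (\<Sum>i\<in>UNIV. ip \<Omega> (\<lambda>x. f x $ i) (\<lambda>x. g x $ i))"
  unfolding ip_def inner_vec_def using assms
  by (intro Bochner_Integration.integral_sum integrable_inner_L2 L2_component)

lemma ip_mult_swap: "ip \<Omega> (\<lambda>x. a x * b x) (c :: _ \<Rightarrow> real) = ip \<Omega> a (\<lambda>x. b x * c x)"
  by (simp add: ip_def mult_ac)

section \<open>Approximation and integration by parts in \<open>H10\<close>\<close>

lemma H10_H1: "v \<in> H10 \<Omega> \<Longrightarrow> v \<in> H1 \<Omega>" and H1_L2: "v \<in> H1 \<Omega> \<Longrightarrow> v \<in> L2 \<Omega>"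
  by (auto simp: H10_def H1_def)

lemma H10_L2: "v \<in> H10 \<Omega> \<Longrightarrow> v \<in> L2 \<Omega>"
  by (simp add: H10_H1 H1_L2)

lemma has_weak_pd_wpd: "v \<in> H1 \<Omega> \<Longrightarrow> has_weak_pd \<Omega> i v (wpd \<Omega> i v)"
  unfolding wpd_def H1_def by (simp add: some_eq_ex)

lemma wpd_L2: "v \<in> H1 \<Omega> \<Longrightarrow> wpd \<Omega> i v \<in> L2 \<Omega>"
  using has_weak_pd_wpd by (auto simp: has_weak_pd_def)

text \<open>The norm approximation in the definition is restated as convergence of pairings, with
  one sequence serving the function and all its partial derivatives.\<close>

lemma H10_approx:
  assumes "v \<in> H10 \<Omega>" and \<Omega>: "\<Omega> \<in> sets lebesgue"
  obtains \<phi> where "\<And>n. \<phi> n \<in> test_functions \<Omega>"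
    and "\<And>g. g \<in> L2 \<Omega> \<Longrightarrow> (\<lambda>n. ip \<Omega> (\<phi> n) g) \<longlonglongrightarrow> ip \<Omega> v g"
    and "\<And>g i. g \<in> L2 \<Omega> \<Longrightarrow> (\<lambda>n. ip \<Omega> (pd i (\<phi> n)) g) \<longlonglongrightarrow> ip \<Omega> (wpd \<Omega> i v) g"
proof -
  obtain \<phi> where \<phi>: "\<forall>n::nat. \<phi> n \<in> test_functions \<Omega>"
      "(\<lambda>n. l2norm \<Omega> (\<lambda>x. \<phi> n x - v x)) \<longlonglongrightarrow> 0"
      "\<And>i. (\<lambda>n. l2norm \<Omega> (\<lambda>x. pd i (\<phi> n) x - wpd \<Omega> i v x)) \<longlonglongrightarrow> 0"
    using assms(1) unfolding H10_def by blast
  have L: "v \<in> L2 \<Omega>" "wpd \<Omega> i v \<in> L2 \<Omega>" "\<phi> n \<in> L2 \<Omega>" "pd i (\<phi> n) \<in> L2 \<Omega>" for i n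
    using assms \<phi>(1) by (auto intro: H10_H1 H1_L2 wpd_L2 test_function_L2 test_function_pd)
  show ?thesis
    using \<phi>(1) by (intro that[of \<phi>] ip_tendsto \<phi>(2,3)) (auto simp: L)
qed

text \<open>For test functions this is the definition of the weak derivative of \<open>a\<close>;
  the limit extends it to \<open>v\<close>. Zero boundary values of \<open>v\<close> alone remove
  the boundary term.\<close>

lemma weak_integration_by_parts:
  assumes \<Omega>: "\<Omega> \<in> sets lebesgue" and v: "v \<in> H10 \<Omega>" and a: "a \<in> L2 \<Omega>" and g: "has_weak_pd \<Omega> i a g"
  shows "ip \<Omega> (wpd \<Omega> i v) a + ip \<Omega> v g = 0"
proof -
  have gL: "g \<in> L2 \<Omega>" using g by (simp add: has_weak_pd_def)
  obtain \<phi> where \<phi>: "\<And>n. \<phi> n \<in> test_functions \<Omega>"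
    and lim: "\<And>g. g \<in> L2 \<Omega> \<Longrightarrow> (\<lambda>n. ip \<Omega> (\<phi> n) g) \<longlonglongrightarrow> ip \<Omega> v g"
      "\<And>g i. g \<in> L2 \<Omega> \<Longrightarrow> (\<lambda>n. ip \<Omega> (pd i (\<phi> n)) g) \<longlonglongrightarrow> ip \<Omega> (wpd \<Omega> i v) g"
    using H10_approx[OF v \<Omega>] by blast
  have "ip \<Omega> (pd i (\<phi> n)) a + ip \<Omega> (\<phi> n) g = 0" for n
    using g \<phi>[of n] by (simp add: has_weak_pd_def ip_commute[of _ _ a] ip_commute[of _ _ g])
  moreover have "(\<lambda>n. ip \<Omega> (pd i (\<phi> n)) a + ip \<Omega> (\<phi> n) g) \<longlonglongrightarrow> ip \<Omega> (wpd \<Omega> i v) a + ip \<Omega> v g"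
    by (intro tendsto_add lim a gL)
  ultimately show ?thesis by (simp add: LIMSEQ_const_iff)
qed

text \<open>With test functions \<psi> approximating \<open>b\<close>, the product of \<phi> and
  \<psi> is an admissible test for the weak derivative of \<open>c\<close>. Expanding its classical
  derivative and passing to the limit gives the rule; boundedness of \<open>b\<close> and
  \<open>c\<close> puts the new derivative in \<open>L2\<close>.\<close>

lemma weak_product_rule:
  assumes \<Omega>: "\<Omega> \<in> sets lebesgue" and b: "b \<in> H10 \<Omega>" "b \<in> Linf \<Omega>" and c: "c \<in> H1 \<Omega>" "c \<in> Linf \<Omega>"
  shows "has_weak_pd \<Omega> i (\<lambda>x. b x * c x) (\<lambda>x. wpd \<Omega> i b x * c x + wpd \<Omega> i c x * b x)"
  unfolding has_weak_pd_def
proof (intro conjI ballI)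
  have L: "b \<in> L2 \<Omega>" "c \<in> L2 \<Omega>" "wpd \<Omega> i b \<in> L2 \<Omega>" "wpd \<Omega> i c \<in> L2 \<Omega>"
    using b c by (auto intro: H10_L2 H10_H1 H1_L2 wpd_L2)
  show "(\<lambda>x. wpd \<Omega> i b x * c x + wpd \<Omega> i c x * b x) \<in> L2 \<Omega>"
    using b c L by (intro L2_add L2_mult)
  fix \<phi> assume \<phi>: "\<phi> \<in> test_functions \<Omega>"
  have pd\<phi>: "pd i \<phi> \<in> test_functions \<Omega>" using \<phi> by (rule test_function_pd)
  have L\<phi>: "(\<lambda>x. c x * pd i \<phi> x) \<in> L2 \<Omega>" "(\<lambda>x. c x * \<phi> x) \<in> L2 \<Omega>" "(\<lambda>x. wpd \<Omega> i c x * \<phi> x) \<in> L2 \<Omega>"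
    using L test_function_Linf[OF \<phi>] test_function_Linf[OF pd\<phi>] by (auto intro: L2_mult)
  obtain \<psi> where \<psi>: "\<And>n. \<psi> n \<in> test_functions \<Omega>"
    and lim: "\<And>g. g \<in> L2 \<Omega> \<Longrightarrow> (\<lambda>n. ip \<Omega> (\<psi> n) g) \<longlonglongrightarrow> ip \<Omega> b g"
      "\<And>g i. g \<in> L2 \<Omega> \<Longrightarrow> (\<lambda>n. ip \<Omega> (pd i (\<psi> n)) g) \<longlonglongrightarrow> ip \<Omega> (wpd \<Omega> i b) g"
    using H10_approx[OF b(1) \<Omega>] by blast
  have "ip \<Omega> (\<psi> n) (\<lambda>x. c x * pd i \<phi> x) + ip \<Omega> (pd i (\<psi> n)) (\<lambda>x. c x * \<phi> x)
      + ip \<Omega> (\<psi> n) (\<lambda>x. wpd \<Omega> i c x * \<phi> x) = 0" for n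
  proof -
    have L\<psi>: "\<psi> n \<in> L2 \<Omega>" "pd i (\<psi> n) \<in> L2 \<Omega>"
      using \<psi> \<Omega> by (auto intro: test_function_L2 test_function_pd)
    have "ip \<Omega> c (pd i (\<lambda>x. \<phi> x * \<psi> n x)) = - ip \<Omega> (wpd \<Omega> i c) (\<lambda>x. \<phi> x * \<psi> n x)"
      using has_weak_pd_wpd[OF c(1)] test_function_mult[OF \<phi> \<psi>] by (auto simp: has_weak_pd_def)
    moreover have "ip \<Omega> c (pd i (\<lambda>x. \<phi> x * \<psi> n x))
        = ip \<Omega> (\<psi> n) (\<lambda>x. c x * pd i \<phi> x) + ip \<Omega> (pd i (\<psi> n)) (\<lambda>x. c x * \<phi> x)"
    proof -
      have "ip \<Omega> c (pd i (\<lambda>x. \<phi> x * \<psi> n x))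
          = (LINT x|lebesgue_on \<Omega>. \<psi> n x \<bullet> (c x * pd i \<phi> x) + pd i (\<psi> n) x \<bullet> (c x * \<phi> x))"
        by (simp add: ip_def pd_test_function_mult[OF \<phi> \<psi>] algebra_simps)
      also have "\<dots> = ip \<Omega> (\<psi> n) (\<lambda>x. c x * pd i \<phi> x) + ip \<Omega> (pd i (\<psi> n)) (\<lambda>x. c x * \<phi> x)"
        unfolding ip_def by (intro Bochner_Integration.integral_add integrable_inner_L2 L\<psi> L\<phi>)
      finally show ?thesis .
    qed
    moreover have "ip \<Omega> (wpd \<Omega> i c) (\<lambda>x. \<phi> x * \<psi> n x) = ip \<Omega> (\<psi> n) (\<lambda>x. wpd \<Omega> i c x * \<phi> x)"
      by (simp add: ip_def mult_ac)
    ultimately show ?thesis by simp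
  qed
  moreover have "(\<lambda>n. ip \<Omega> (\<psi> n) (\<lambda>x. c x * pd i \<phi> x) + ip \<Omega> (pd i (\<psi> n)) (\<lambda>x. c x * \<phi> x)
      + ip \<Omega> (\<psi> n) (\<lambda>x. wpd \<Omega> i c x * \<phi> x))
    \<longlonglongrightarrow> ip \<Omega> b (\<lambda>x. c x * pd i \<phi> x) + ip \<Omega> (wpd \<Omega> i b) (\<lambda>x. c x * \<phi> x)
      + ip \<Omega> b (\<lambda>x. wpd \<Omega> i c x * \<phi> x)"
    by (intro tendsto_add lim L\<phi>)
  ultimately have "ip \<Omega> b (\<lambda>x. c x * pd i \<phi> x) + ip \<Omega> (wpd \<Omega> i b) (\<lambda>x. c x * \<phi> x)
      + ip \<Omega> b (\<lambda>x. wpd \<Omega> i c x * \<phi> x) = 0" by (simp add: LIMSEQ_const_iff)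
  moreover have "ip \<Omega> (\<lambda>x. wpd \<Omega> i b x * c x + wpd \<Omega> i c x * b x) \<phi>
      = ip \<Omega> (\<lambda>x. wpd \<Omega> i b x * c x) \<phi> + ip \<Omega> (\<lambda>x. wpd \<Omega> i c x * b x) \<phi>"
    using b c L test_function_L2[OF \<phi> \<Omega>] by (intro ip_add_left L2_mult)
  moreover have "ip \<Omega> (\<lambda>x. wpd \<Omega> i c x * b x) \<phi> = ip \<Omega> b (\<lambda>x. wpd \<Omega> i c x * \<phi> x)"
    by (simp add: ip_def mult_ac)
  ultimately show "ip \<Omega> (\<lambda>x. b x * c x) (pd i \<phi>)
      = - ip \<Omega> (\<lambda>x. wpd \<Omega> i b x * c x + wpd \<Omega> i c x * b x) \<phi>"
    by (simp add: ip_mult_swap)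
qed

section \<open>Divergence and convection of vector fields\<close>

lemma sgrad_L2: "v \<in> H1 \<Omega> \<Longrightarrow> sgrad \<Omega> v \<in> L2 \<Omega>"
  by (rule L2_vec) (simp add: sgrad_def wpd_L2)

lemma H10_vecD: "u \<in> H10_vec \<Omega> \<Longrightarrow> (\<lambda>x. u x $ i) \<in> H10 \<Omega>"
  by (simp add: H10_vec_def)

lemma H10_vec_L2: "u \<in> H10_vec \<Omega> \<Longrightarrow> u \<in> L2 \<Omega>"
  by (rule L2_vec) (simp add: H10_vecD H10_L2)

lemma divg_L2: "u \<in> H10_vec \<Omega> \<Longrightarrow> divg \<Omega> u \<in> L2 \<Omega>"
  unfolding divg_def[abs_def] by (intro L2_sum wpd_L2 H10_H1 H10_vecD)

lemma inner_sgrad_L2: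
  assumes "u \<in> Linf \<Omega>" "v \<in> H1 \<Omega>"
  shows "(\<lambda>x. u x \<bullet> sgrad \<Omega> v x) \<in> L2 \<Omega>"
proof -
  have "(\<lambda>x. \<Sum>i\<in>UNIV. wpd \<Omega> i v x * u x $ i) \<in> L2 \<Omega>"
    using assms by (intro L2_sum L2_mult wpd_L2 Linf_component)
  then show ?thesis by (simp add: inner_vec_def sgrad_def mult.commute)
qed

lemma grad_mult_nth: "(grad \<Omega> v x *v u x) $ i = u x \<bullet> sgrad \<Omega> (\<lambda>y. v y $ i) x"
  by (simp add: matrix_vector_mult_def grad_def sgrad_def inner_vec_def mult.commute)

lemma grad_mult_L2:
  assumes "u \<in> Linf \<Omega>" "v \<in> H10_vec \<Omega>"
  shows "(\<lambda>x. grad \<Omega> v x *v u x) \<in> L2 \<Omega>"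
  using assms by (intro L2_vec) (simp add: grad_mult_nth inner_sgrad_L2 H10_H1 H10_vecD)

lemma divg_integration_by_parts:
  assumes \<Omega>: "\<Omega> \<in> sets lebesgue" and u: "u \<in> H10_vec \<Omega>" and b: "b \<in> H1 \<Omega>"
  shows "ip \<Omega> u (sgrad \<Omega> b) + ip \<Omega> (divg \<Omega> u) b = 0"
proof -
  have "ip \<Omega> u (sgrad \<Omega> b) = (\<Sum>i\<in>UNIV. ip \<Omega> (\<lambda>x. u x $ i) (wpd \<Omega> i b))"
    using u b by (subst ip_vec) (simp_all add: H10_vec_L2 sgrad_L2, simp add: sgrad_def)
  moreover have "ip \<Omega> (divg \<Omega> u) b = (\<Sum>i\<in>UNIV. ip \<Omega> (wpd \<Omega> i (\<lambda>x. u x $ i)) b)"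
    unfolding ip_def divg_def inner_sum_left
    by (intro Bochner_Integration.integral_sum integrable_inner_L2 H1_L2[OF b] wpd_L2 H10_H1 H10_vecD[OF u])
  moreover have "ip \<Omega> (wpd \<Omega> i (\<lambda>x. u x $ i)) b + ip \<Omega> (\<lambda>x. u x $ i) (wpd \<Omega> i b) = 0" for i
    using u b by (intro weak_integration_by_parts[OF \<Omega>] has_weak_pd_wpd H10_vecD H1_L2)
  ultimately show ?thesis by (simp add: add.commute flip: sum.distrib)
qed

text \<open>This is the vanishing integral of the divergence of \<open>b c u\<close>. Each component
  of \<open>u\<close> is integrated by parts against \<open>b c\<close>, whose weak derivative comes
  from the product rule, and the coordinates are summed.\<close>

lemma scalar_transport_identity:
  assumes \<Omega>: "\<Omega> \<in> sets lebesgue" and u: "u \<in> H10_vec \<Omega>" "u \<in> Linf \<Omega>"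
    and b: "b \<in> H10 \<Omega>" "b \<in> Linf \<Omega>" and c: "c \<in> H10 \<Omega>" "c \<in> Linf \<Omega>"
  shows "ip \<Omega> (\<lambda>x. u x \<bullet> sgrad \<Omega> b x) c + ip \<Omega> (\<lambda>x. u x \<bullet> sgrad \<Omega> c x) b
      + ip \<Omega> (\<lambda>x. divg \<Omega> u x * b x) c = 0"
proof -
  have bc: "(\<lambda>x. b x * c x) \<in> L2 \<Omega>" using b c by (intro L2_mult H10_L2)
  have ui: "(\<lambda>x. u x $ i) \<in> H10 \<Omega>" for i using u by (simp add: H10_vecD)
  have Lb: "wpd \<Omega> i b \<in> L2 \<Omega>" and Lc: "wpd \<Omega> i c \<in> L2 \<Omega>" for i
    using b c by (auto intro: wpd_L2 H10_H1)
  have "ip \<Omega> (\<lambda>x. u x \<bullet> sgrad \<Omega> b x) c = (\<Sum>i\<in>UNIV. ip \<Omega> (\<lambda>x. u x $ i) (\<lambda>x. wpd \<Omega> i b x * c x))"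
    if "b \<in> H10 \<Omega>" "c \<in> Linf \<Omega>" for b c
  proof -
    have "ip \<Omega> (\<lambda>x. u x \<bullet> sgrad \<Omega> b x) c = (LINT x|lebesgue_on \<Omega>. (\<Sum>i\<in>UNIV. u x $ i \<bullet> (wpd \<Omega> i b x * c x)))"
      by (simp add: ip_def inner_vec_def sgrad_def sum_distrib_right mult.assoc)
    also have "\<dots> = (\<Sum>i\<in>UNIV. ip \<Omega> (\<lambda>x. u x $ i) (\<lambda>x. wpd \<Omega> i b x * c x))"
      unfolding ip_def using ui that
      by (intro Bochner_Integration.integral_sum integrable_inner_L2 L2_mult H10_L2 wpd_L2 H10_H1)
    finally show ?thesis .
  qed
  note expand = this[OF b(1) c(2)] this[OF c(1) b(2)]
  have div: "ip \<Omega> (\<lambda>x. divg \<Omega> u x * b x) c = (\<Sum>i\<in>UNIV. ip \<Omega> (wpd \<Omega> i (\<lambda>x. u x $ i)) (\<lambda>x. b x * c x))"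
    unfolding ip_mult_swap ip_def divg_def inner_sum_left using ui bc
    by (intro Bochner_Integration.integral_sum integrable_inner_L2 wpd_L2 H10_H1)
  have "ip \<Omega> (wpd \<Omega> i (\<lambda>x. u x $ i)) (\<lambda>x. b x * c x) + ip \<Omega> (\<lambda>x. u x $ i) (\<lambda>x. wpd \<Omega> i b x * c x)
      + ip \<Omega> (\<lambda>x. u x $ i) (\<lambda>x. wpd \<Omega> i c x * b x) = 0" for i
  proof -
    have "ip \<Omega> (wpd \<Omega> i (\<lambda>x. u x $ i)) (\<lambda>x. b x * c x)
        + ip \<Omega> (\<lambda>x. u x $ i) (\<lambda>x. wpd \<Omega> i b x * c x + wpd \<Omega> i c x * b x) = 0"
      using b c by (intro weak_integration_by_parts[OF \<Omega> ui bc] weak_product_rule[OF \<Omega>] H10_H1)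
    moreover have "ip \<Omega> (\<lambda>x. u x $ i) (\<lambda>x. wpd \<Omega> i b x * c x + wpd \<Omega> i c x * b x)
        = ip \<Omega> (\<lambda>x. u x $ i) (\<lambda>x. wpd \<Omega> i b x * c x) + ip \<Omega> (\<lambda>x. u x $ i) (\<lambda>x. wpd \<Omega> i c x * b x)"
      using b c Lb Lc by (intro ip_add_right L2_mult H10_L2[OF ui])
    ultimately show ?thesis by simp
  qed
  then have "(\<Sum>i\<in>UNIV. ip \<Omega> (wpd \<Omega> i (\<lambda>x. u x $ i)) (\<lambda>x. b x * c x) + ip \<Omega> (\<lambda>x. u x $ i) (\<lambda>x. wpd \<Omega> i b x * c x)
      + ip \<Omega> (\<lambda>x. u x $ i) (\<lambda>x. wpd \<Omega> i c x * b x)) = 0" by simp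
  then show ?thesis unfolding expand div sum.distrib by simp
qed

lemma transport_identity:
  assumes \<Omega>: "\<Omega> \<in> sets lebesgue" and u: "u \<in> H10_vec \<Omega>" "u \<in> Linf \<Omega>"
    and v: "v \<in> H10_vec \<Omega>" "v \<in> Linf \<Omega>" and w: "w \<in> H10_vec \<Omega>" "w \<in> Linf \<Omega>"
  shows "conv \<Omega> u v w + conv \<Omega> u w v + ip \<Omega> (\<lambda>x. divg \<Omega> u x *\<^sub>R v x) w = 0"
proof -
  have "conv \<Omega> u v w = (\<Sum>i\<in>UNIV. ip \<Omega> (\<lambda>x. u x \<bullet> sgrad \<Omega> (\<lambda>y. v y $ i) x) (\<lambda>x. w x $ i))"
    if "v \<in> H10_vec \<Omega>" "w \<in> H10_vec \<Omega>" for v w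
    unfolding conv_def using u that by (subst ip_vec) (auto simp: grad_mult_L2 H10_vec_L2 grad_mult_nth)
  note expand = this[OF v(1) w(1)] this[OF w(1) v(1)]
  have div: "ip \<Omega> (\<lambda>x. divg \<Omega> u x *\<^sub>R v x) w = (\<Sum>i\<in>UNIV. ip \<Omega> (\<lambda>x. divg \<Omega> u x * v x $ i) (\<lambda>x. w x $ i))"
    using u v w by (subst ip_vec) (auto intro: L2_scaleR_Linf divg_L2 H10_vec_L2)
  have "(\<Sum>i\<in>UNIV. ip \<Omega> (\<lambda>x. u x \<bullet> sgrad \<Omega> (\<lambda>y. v y $ i) x) (\<lambda>x. w x $ i)
      + ip \<Omega> (\<lambda>x. u x \<bullet> sgrad \<Omega> (\<lambda>y. w y $ i) x) (\<lambda>x. v x $ i)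
      + ip \<Omega> (\<lambda>x. divg \<Omega> u x * v x $ i) (\<lambda>x. w x $ i)) = 0"
    using u v w by (intro sum.neutral ballI scalar_transport_identity[OF \<Omega>] H10_vecD Linf_component)
  then show ?thesis unfolding expand div sum.distrib .
qed

lemma double_symgrad:
  "2 *\<^sub>R (symgrad \<Omega> u x *v y) = grad \<Omega> u x *v y + transpose (grad \<Omega> u x) *v y"
  by (simp add: symgrad_def scaleR_matrix_vector_assoc matrix_vector_mult_add_rdistrib)

text \<open>Moving the transposed gradient to the other side of the inner product turns its half of
  the symmetric gradient into \<open>conv \<Omega> w u u\<close>.\<close>

lemma ip_symgrad:
  assumes u: "u \<in> H10_vec \<Omega>" "u \<in> Linf \<Omega>" and w: "w \<in> H10_vec \<Omega>" "w \<in> Linf \<Omega>"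
  shows "ip \<Omega> (\<lambda>x. 2 *\<^sub>R (symgrad \<Omega> u x *v u x)) w = conv \<Omega> u u w + conv \<Omega> w u u"
proof -
  have "ip \<Omega> (\<lambda>x. 2 *\<^sub>R (symgrad \<Omega> u x *v u x)) w
      = (LINT x|lebesgue_on \<Omega>. (grad \<Omega> u x *v u x) \<bullet> w x + (grad \<Omega> u x *v w x) \<bullet> u x)"
    unfolding ip_def double_symgrad
    by (intro Bochner_Integration.integral_cong)
      (simp_all add: inner_add_left transpose_matrix_vector dot_lmul_matrix inner_commute[of "u _"])
  also have "\<dots> = conv \<Omega> u u w + conv \<Omega> w u u"
    unfolding conv_def ip_def using u w
    by (intro Bochner_Integration.integral_add integrable_inner_L2 grad_mult_L2 H10_vec_L2)
  finally show ?thesis .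
qed

lemma symgrad_mult_L2:
  assumes u: "u \<in> H10_vec \<Omega>" "u \<in> Linf \<Omega>"
  shows "(\<lambda>x. 2 *\<^sub>R (symgrad \<Omega> u x *v u x)) \<in> L2 \<Omega>"
proof (intro L2_vec)
  fix i
  have eq: "(2 *\<^sub>R (symgrad \<Omega> u x *v u x)) $ i
      = (\<Sum>j\<in>UNIV. wpd \<Omega> j (\<lambda>y. u y $ i) x * u x $ j + wpd \<Omega> i (\<lambda>y. u y $ j) x * u x $ j)" for x
    unfolding double_symgrad by (simp add: matrix_vector_mult_def grad_def transpose_def sum.distrib)
  show "(\<lambda>x. (2 *\<^sub>R (symgrad \<Omega> u x *v u x)) $ i) \<in> L2 \<Omega>"
    unfolding eq using u by (intro L2_sum L2_add L2_mult wpd_L2 Linf_component H10_H1 H10_vecD)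
qed

section \<open>Finite element functions on the mesh\<close>

lemma AE_lebesgue_on:
  "S \<in> sets lebesgue \<Longrightarrow> (AE x in lebesgue_on S. P x) \<longleftrightarrow> (AE x in lebesgue. x \<in> S \<longrightarrow> P x)"
  by (simp add: AE_restrict_space_iff)

text \<open>Frontiers of convex sets are null sets and there are finitely many elements. The
  description of finite element functions on open elements thus determines them almost
  everywhere.\<close>

lemma AE_mesh_interior:
  assumes "admissible_mesh \<Omega> \<T>"
  shows "AE x in lebesgue. \<forall>T\<in>\<T>. x \<in> T \<longrightarrow> x \<in> interior T"
proof (rule AE_finite_allI)
  show "finite \<T>" using assms by (simp add: admissible_mesh_def triangulation_def)
  fix T assume "T \<in> \<T>"
  then have "convex T" "closed T"
    using assms by (auto simp: admissible_mesh_def intro: convex_simplex closed_simplex)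
  then have "AE x in lebesgue. x \<notin> frontier T"
    by (intro AE_not_in) (simp add: negligible_convex_frontier flip: negligible_iff_null_sets)
  then show "AE x in lebesgue. x \<in> T \<longrightarrow> x \<in> interior T"
    by eventually_elim (auto simp: frontier_def closure_closed \<open>closed T\<close>)
qed

text \<open>On each element the function agrees with a polynomial, which is bounded on the compact
  simplex.\<close>

lemma fe_space_AE_bounded:
  assumes mesh: "admissible_mesh \<Omega> \<T>" and V: "fe_space \<T> V" "v \<in> V" and \<Omega>: "\<Omega> \<in> sets lebesgue"
  shows "\<exists>M. AE x in lebesgue_on \<Omega>. norm (v x) \<le> M"
proof -
  have fin: "finite \<T>" using mesh by (simp add: admissible_mesh_def triangulation_def)
  have "\<exists>M. \<forall>x\<in>interior T. norm (v x) \<le> M" if T: "T \<in> \<T>" for T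
  proof -
    have "\<forall>v\<in>V. \<forall>T\<in>\<T>. \<exists>P. polynomial_function P \<and> (\<forall>x\<in>interior T. v x = P x)"
      using V(1) by (simp add: fe_space_def)
    from bspec[OF bspec[OF this V(2)] T]
    obtain P where P: "polynomial_function P" "\<And>x. x \<in> interior T \<Longrightarrow> v x = P x"
      by auto
    have "compact T" using mesh T by (auto simp: admissible_mesh_def intro: compact_simplex)
    then have "bounded (P ` T)"
      by (rule compact_imp_bounded[OF compact_continuous_image[OF continuous_on_polymonial_function[OF P(1)]]])
    then obtain M where "\<forall>y\<in>P ` T. norm y \<le> M" unfolding bounded_iff by blast
    then show ?thesis using P(2) interior_subset[of T] by (intro exI[of _ M]) auto
  qed
  then obtain M where M: "\<And>T x. T \<in> \<T> \<Longrightarrow> x \<in> interior T \<Longrightarrow> norm (v x) \<le> M T" by metis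
  \<comment> \<open>The sum of absolute values bounds every local constant at once; on an element
    with empty interior \<open>M T\<close> could be negative.\<close>
  have "AE x in lebesgue. x \<in> \<Omega> \<longrightarrow> norm (v x) \<le> (\<Sum>T\<in>\<T>. \<bar>M T\<bar>)"
    using AE_mesh_interior[OF mesh]
  proof eventually_elim
    case (elim x)
    show ?case
    proof
      assume "x \<in> \<Omega>"
      then have "x \<in> \<Union>\<T>" using mesh closure_subset[of \<Omega>] by (auto simp: admissible_mesh_def)
      then obtain T where T: "T \<in> \<T>" "x \<in> interior T" using elim by auto
      then have "norm (v x) \<le> \<bar>M T\<bar>" using M by fastforce
      also have "\<dots> \<le> (\<Sum>T\<in>\<T>. \<bar>M T\<bar>)" using fin T by (intro member_le_sum) auto
      finally show "norm (v x) \<le> (\<Sum>T\<in>\<T>. \<bar>M T\<bar>)" .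
    qed
  qed
  then show ?thesis using \<Omega> by (auto simp: AE_lebesgue_on)
qed

lemma fe_space_zero: "fe_space \<T> V \<Longrightarrow> (\<lambda>x. 0) \<in> V"
  unfolding fe_space_def by (auto intro!: range_eqI[of _ _ "\<lambda>_. 0"])

text \<open>The right-hand side is the pairing of \<open>F\<close> with the curl of
  \<open>c\<close>, grouped by components of \<open>F\<close>. The weak curl identity extends from
  test fields to \<open>c\<close> by density.\<close>

lemma ip_wcurl:
  assumes \<Omega>: "\<Omega> \<in> sets lebesgue" and F: "F \<in> L2 \<Omega>" "has_weak_curl \<Omega> F g" and c: "c \<in> H10_vec \<Omega>"
  shows "ip \<Omega> g c =
      (ip \<Omega> (wpd \<Omega> 2 (\<lambda>x. c x $ 3)) (\<lambda>x. F x $ 1) - ip \<Omega> (wpd \<Omega> 3 (\<lambda>x. c x $ 2)) (\<lambda>x. F x $ 1))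
    + (ip \<Omega> (wpd \<Omega> 3 (\<lambda>x. c x $ 1)) (\<lambda>x. F x $ 2) - ip \<Omega> (wpd \<Omega> 1 (\<lambda>x. c x $ 3)) (\<lambda>x. F x $ 2))
    + (ip \<Omega> (wpd \<Omega> 1 (\<lambda>x. c x $ 2)) (\<lambda>x. F x $ 3) - ip \<Omega> (wpd \<Omega> 2 (\<lambda>x. c x $ 1)) (\<lambda>x. F x $ 3))"
    (is "_ = ?R")
proof -
  have gL: "g \<in> L2 \<Omega>" using F by (simp add: has_weak_curl_def)
  note Fi = L2_component[OF F(1)] and gi = L2_component[OF gL]
  \<comment> \<open>Each component of \<open>c\<close> has its own approximating sequence; together
    they form the test fields below.\<close>
  have "\<exists>\<Phi>. (\<forall>n::nat. \<Phi> n \<in> test_functions \<Omega>)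
      \<and> (\<forall>g\<in>L2 \<Omega>. (\<lambda>n. ip \<Omega> (\<Phi> n) g) \<longlonglongrightarrow> ip \<Omega> (\<lambda>x. c x $ k) g)
      \<and> (\<forall>g\<in>L2 \<Omega>. \<forall>i. (\<lambda>n. ip \<Omega> (pd i (\<Phi> n)) g) \<longlonglongrightarrow> ip \<Omega> (wpd \<Omega> i (\<lambda>x. c x $ k)) g)" for k
    using H10_approx[OF H10_vecD[OF c] \<Omega>, of k] by metis
  then obtain \<Phi> where \<Phi>: "\<And>k (n::nat). \<Phi> k n \<in> test_functions \<Omega>"
    and lim: "\<And>k g. g \<in> L2 \<Omega> \<Longrightarrow> (\<lambda>n. ip \<Omega> (\<Phi> k n) g) \<longlonglongrightarrow> ip \<Omega> (\<lambda>x. c x $ k) g"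
      "\<And>k i g. g \<in> L2 \<Omega> \<Longrightarrow> (\<lambda>n. ip \<Omega> (pd i (\<Phi> k n)) g) \<longlonglongrightarrow> ip \<Omega> (wpd \<Omega> i (\<lambda>x. c x $ k)) g"
    by metis
  have \<Phi>L: "\<Phi> k n \<in> L2 \<Omega>" "pd i (\<Phi> k n) \<in> L2 \<Omega>" for i k n
    using \<Phi> \<Omega> by (auto intro: test_function_L2 test_function_pd)
  define \<phi> where "\<phi> n x = (\<chi> k. \<Phi> k n x)" for n x
  have comp: "(\<lambda>x. \<phi> n x $ k) = \<Phi> k n" for n k by (simp add: \<phi>_def)
  have \<phi>L: "\<phi> n \<in> L2 \<Omega>" for n by (rule L2_vec) (simp add: comp \<Phi>L)
  let ?R' = "\<lambda>n. (ip \<Omega> (pd 2 (\<Phi> 3 n)) (\<lambda>x. F x $ 1) - ip \<Omega> (pd 3 (\<Phi> 2 n)) (\<lambda>x. F x $ 1))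
    + (ip \<Omega> (pd 3 (\<Phi> 1 n)) (\<lambda>x. F x $ 2) - ip \<Omega> (pd 1 (\<Phi> 3 n)) (\<lambda>x. F x $ 2))
    + (ip \<Omega> (pd 1 (\<Phi> 2 n)) (\<lambda>x. F x $ 3) - ip \<Omega> (pd 2 (\<Phi> 1 n)) (\<lambda>x. F x $ 3))"
  have eq: "ip \<Omega> (\<phi> n) g = ?R' n" for n
  proof -
    have tc: "test_curl (\<phi> n) \<in> L2 \<Omega>"
    proof (rule L2_vec)
      fix i :: 3
      show "(\<lambda>x. test_curl (\<phi> n) x $ i) \<in> L2 \<Omega>"
        using exhaust_3[of i] by (auto simp: test_curl_def comp vector_3 intro!: L2_diff \<Phi>L)
    qed
    have "ip \<Omega> (\<phi> n) g = ip \<Omega> (test_curl (\<phi> n)) F"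
      using F(2) \<Phi> comp by (simp add: has_weak_curl_def ip_commute)
    also have "\<dots> = ?R' n"
      unfolding ip_vec[OF tc F(1)] sum_3
      by (simp add: test_curl_def comp vector_3 ip_diff_left \<Phi>L Fi)
    finally show ?thesis .
  qed
  have "(\<lambda>n. ip \<Omega> (\<phi> n) g) \<longlonglongrightarrow> ?R"
    unfolding eq by (intro tendsto_intros lim Fi)
  moreover have "(\<lambda>n. ip \<Omega> (\<phi> n) g) \<longlonglongrightarrow> ip \<Omega> c g"
    unfolding ip_vec[OF \<phi>L gL] ip_vec[OF H10_vec_L2[OF c] gL] comp
    by (intro tendsto_intros lim gi)
  ultimately have "ip \<Omega> c g = ?R" by (rule LIMSEQ_unique[rotated])
  then show ?thesis by (simp add: ip_commute)
qed

text \<open>Serves both a forcing that vanishes everywhere and a cutoff whose gradient vanishes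
  wherever the forcing does not.\<close>

lemma ip_wcurl_eq_0:
  assumes \<Omega>: "\<Omega> \<in> sets lebesgue" and F: "F \<in> L2 \<Omega>" "has_weak_curl \<Omega> F g" and c: "c \<in> H10_vec \<Omega>"
    and ae: "AE x in lebesgue_on \<Omega>. F x = 0 \<or> grad \<Omega> c x = 0"
  shows "ip \<Omega> g c = 0"
proof -
  have "ip \<Omega> (wpd \<Omega> j (\<lambda>x. c x $ k)) (\<lambda>x. F x $ i) = 0" for i j k
  proof (rule ip_eq_0_AE)
    show "AE x in lebesgue_on \<Omega>. wpd \<Omega> j (\<lambda>x. c x $ k) x \<bullet> (F x $ i) = 0"
      using ae by eventually_elim (auto simp: grad_def vec_eq_iff)
  qed
  then show ?thesis by (simp add: ip_wcurl[OF \<Omega> F c])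
qed

lemma constant_on_if_zero_derivative:
  fixes h :: "real \<Rightarrow> real"
  assumes "is_interval I" and "\<And>t. t \<in> I \<Longrightarrow> (h has_real_derivative 0) (at t within I)"
  shows "h constant_on I"
  using has_field_derivative_zero_constant[of I h] assms
  by (auto simp: constant_on_def is_interval_convex)

section \<open>Consequences of the mesh, the strip and the core\<close>

context fe_discretization
begin

lemma lebesgue_domain: "\<Omega> \<in> sets lebesgue"
  using domain(1) by simp

lemma fe_space_Linf:
  assumes "fe_space \<T> V" "v \<in> V" "v \<in> L2 \<Omega>"
  shows "v \<in> Linf \<Omega>"
  using fe_space_AE_bounded[OF mesh assms(1,2) lebesgue_domain] L2_measurable[OF assms(3)]
  by (simp add: Linf_def)

lemma velocity_H10: "v \<in> X \<Longrightarrow> v \<in> H10_vec \<Omega>"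
  using velocity_space(2) by blast

lemma velocity_L2: "v \<in> X \<Longrightarrow> v \<in> L2 \<Omega>"
  by (simp add: H10_vec_L2 velocity_H10)

lemma velocity_Linf: "v \<in> X \<Longrightarrow> v \<in> Linf \<Omega>"
  using fe_space_Linf[OF velocity_space(1)] by (simp add: velocity_L2)

text \<open>Testing with zero in one slot separates the constraint from the evolution
  equation.\<close>

lemma velocity_zero: "(\<lambda>x. 0) \<in> X" and pressure_zero: "(\<lambda>x. 0) \<in> Q"
  using fe_space_zero velocity_space(1) pressure_space(1) by blast+

text \<open>The strip is cut out of \<Omega> by finitely many closed elements. Openness of the core
  allows localising weak derivatives to it.\<close>

lemma open_core: "open \<Omega>h" and core_subset: "\<Omega>h \<subseteq> \<Omega>"
proof -
  show "\<Omega>h \<subseteq> \<Omega>" using strip by (auto simp: boundary_strip_def)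
  obtain S where S: "S \<subseteq> \<T>" "\<Omega> - \<Omega>h = \<Omega> \<inter> \<Union>S"
    using strip by (auto simp: boundary_strip_def)
  then have eq: "\<Omega>h = \<Omega> - \<Union>S" using \<open>\<Omega>h \<subseteq> \<Omega>\<close> by auto
  have "closed (\<Union>S)"
    using S(1) mesh finite_subset[OF S(1)]
    by (intro closed_Union) (auto simp: admissible_mesh_def triangulation_def intro: closed_simplex)
  then show "open \<Omega>h" unfolding eq by (intro open_Diff domain)
qed

lemma strip_lebesgue: "\<Omega> - \<Omega>h \<in> sets lebesgue" and core_lebesgue: "\<Omega>h \<in> sets lebesgue"
  using domain(1) open_core by auto

lemma vanishes_on_strip: "vanishes_on (\<Omega> - \<Omega>h) v \<longleftrightarrow> (AE x in lebesgue. x \<in> \<Omega> - \<Omega>h \<longrightarrow> v x = 0)"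
  unfolding vanishes_on_def by (rule AE_lebesgue_on[OF strip_lebesgue])

text \<open>The strip is only relatively closed in \<Omega>. The localisation result is applied to
  the open union of the element interiors, which differs from the strip by a null set.\<close>

lemma wpd_strip_eq_0:
  assumes v: "v \<in> H1 \<Omega>" and zero: "AE x in lebesgue. x \<in> \<Omega> - \<Omega>h \<longrightarrow> v x = 0"
  shows "AE x in lebesgue. x \<in> \<Omega> - \<Omega>h \<longrightarrow> wpd \<Omega> i v x = 0"
proof -
  obtain S where S: "S \<subseteq> \<T>" "\<Omega> - \<Omega>h = \<Omega> \<inter> \<Union>S"
    using strip by (auto simp: boundary_strip_def)
  let ?U = "\<Union>(interior ` S)"
  have U: "open ?U" "?U \<subseteq> \<Omega>" using mesh S(1) by (auto simp: admissible_mesh_def)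
  have U': "?U \<subseteq> \<Omega> - \<Omega>h"
    unfolding S(2) using U(2) interior_subset by blast
  have "AE x in lebesgue. x \<in> ?U \<longrightarrow> v x = 0"
    using zero by eventually_elim (use U' in blast)
  then have "AE x in lebesgue. x \<in> ?U \<longrightarrow> wpd \<Omega> i v x = 0"
    by (rule weak_pd_eq_0_if_const[OF lebesgue_domain U H1_L2[OF v] has_weak_pd_wpd[OF v]])
  then show ?thesis
    using AE_mesh_interior[OF mesh] unfolding S(2) by eventually_elim (use S(1) in auto)
qed

lemma grad_strip_eq_0:
  assumes v: "v \<in> X" and zero: "vanishes_on (\<Omega> - \<Omega>h) v"
  shows "AE x in lebesgue. x \<in> \<Omega> - \<Omega>h \<longrightarrow> grad \<Omega> v x = 0"
proof -
  have "AE x in lebesgue. x \<in> \<Omega> - \<Omega>h \<longrightarrow> wpd \<Omega> j (\<lambda>y. v y $ i) x = 0" for i j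
    using zero[unfolded vanishes_on_strip] H10_H1[OF H10_vecD[OF velocity_H10[OF v]]]
    by (intro wpd_strip_eq_0) (auto elim: eventually_mono)
  then have "AE x in lebesgue. \<forall>i j. x \<in> \<Omega> - \<Omega>h \<longrightarrow> wpd \<Omega> j (\<lambda>y. v y $ i) x = 0"
    by (intro AE_all_countable[THEN iffD2] allI)
  then show ?thesis by eventually_elim (simp add: grad_def vec_eq_iff)
qed

lemma grad_core_eq_0:
  assumes c: "c \<in> X" "AE x in lebesgue. x \<in> \<Omega>h \<longrightarrow> c x = e"
  shows "AE x in lebesgue. x \<in> \<Omega>h \<longrightarrow> grad \<Omega> c x = 0"
proof -
  have "AE x in lebesgue. x \<in> \<Omega>h \<longrightarrow> wpd \<Omega> j (\<lambda>y. c y $ i) x = 0" for i j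
  proof (rule weak_pd_eq_0_if_const[OF lebesgue_domain open_core core_subset])
    show "(\<lambda>y. c y $ i) \<in> L2 \<Omega>" using velocity_L2[OF c(1)] by (rule L2_component)
    show "has_weak_pd \<Omega> j (\<lambda>y. c y $ i) (wpd \<Omega> j (\<lambda>y. c y $ i))"
      by (intro has_weak_pd_wpd H10_H1 H10_vecD velocity_H10 c)
    show "AE x in lebesgue. x \<in> \<Omega>h \<longrightarrow> c x $ i = e $ i"
      using c(2) by eventually_elim auto
  qed
  then have "AE x in lebesgue. \<forall>i j. x \<in> \<Omega>h \<longrightarrow> wpd \<Omega> j (\<lambda>y. c y $ i) x = 0"
    by (intro AE_all_countable[THEN iffD2] allI)
  then show ?thesis by eventually_elim (simp add: grad_def vec_eq_iff)
qed

end

section \<open>Conservation laws\<close>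

context ema_flow
begin

lemma velocity_at: "t \<in> I \<Longrightarrow> u t \<in> X"
  using discrete by blast

text \<open>Separates the coupled equation into momentum balance and discrete incompressibility, and
  rewrites the symmetric gradient term by \<open>ip_symgrad\<close>.\<close>

lemma ema_tested:
  assumes t: "t \<in> I"
  obtains ut where "has_time_derivative \<Omega> I u t ut"
    and "\<And>v. v \<in> X \<Longrightarrow> ip \<Omega> ut v + (conv \<Omega> (u t) (u t) v + conv \<Omega> v (u t) (u t))
        + ip \<Omega> (\<lambda>x. divg \<Omega> (u t) x *\<^sub>R u t x) v - ip \<Omega> (p t) (divg \<Omega> v)
        + \<nu> * ip \<Omega> (grad \<Omega> (u t)) (grad \<Omega> v) = ip \<Omega> (f t) v"
    and "\<And>q. q \<in> Q \<Longrightarrow> ip \<Omega> q (divg \<Omega> (u t)) = 0"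
proof -
  obtain ut where ut: "has_time_derivative \<Omega> I u t ut" and eq: "\<And>v q. v \<in> X \<Longrightarrow> q \<in> Q \<Longrightarrow>
      ip \<Omega> (\<lambda>x. ut x + 2 *\<^sub>R (symgrad \<Omega> (u t) x *v u t x) + divg \<Omega> (u t) x *\<^sub>R u t x) v
      - ip \<Omega> (p t) (divg \<Omega> v) + ip \<Omega> q (divg \<Omega> (u t)) + \<nu> * ip \<Omega> (grad \<Omega> (u t)) (grad \<Omega> v)
      = ip \<Omega> (f t) v"
    using ema t by blast
  note ut_X = velocity_at[OF t]
  have z: "ip \<Omega> (\<lambda>x. 0) (divg \<Omega> (u t)) = 0" by (simp add: ip_def)
  \<comment> \<open>With \<open>v = 0\<close>, the equations for \<open>q\<close> and for the zero
    pressure differ only in the constraint term.\<close>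
  have div: "ip \<Omega> q (divg \<Omega> (u t)) = 0" if "q \<in> Q" for q
    using eq[OF velocity_zero that] eq[OF velocity_zero pressure_zero] by (simp add: z)
  have "ip \<Omega> ut v + (conv \<Omega> (u t) (u t) v + conv \<Omega> v (u t) (u t))
        + ip \<Omega> (\<lambda>x. divg \<Omega> (u t) x *\<^sub>R u t x) v - ip \<Omega> (p t) (divg \<Omega> v)
        + \<nu> * ip \<Omega> (grad \<Omega> (u t)) (grad \<Omega> v) = ip \<Omega> (f t) v" if v: "v \<in> X" for v
  proof -
    have L: "ut \<in> L2 \<Omega>" "(\<lambda>x. 2 *\<^sub>R (symgrad \<Omega> (u t) x *v u t x)) \<in> L2 \<Omega>"
      "(\<lambda>x. divg \<Omega> (u t) x *\<^sub>R u t x) \<in> L2 \<Omega>" "v \<in> L2 \<Omega>"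
      using ut ut_X v by (auto simp: has_time_derivative_def
          intro: symgrad_mult_L2 L2_scaleR_Linf divg_L2 velocity_H10 velocity_Linf velocity_L2)
    show ?thesis
      using eq[OF v pressure_zero] ut_X v
      by (simp add: z ip_add_left L L2_add ip_symgrad velocity_H10 velocity_Linf)
  qed
  with ut div show ?thesis using that by blast
qed

end

text \<open>Adding the momentum equation tested with \<open>w\<close> and (V1) tested with
  \<open>u\<close> cancels \<open>conv \<Omega> w u u\<close>; the remaining convective terms form
  the transport identity.\<close>

lemma helicity_conserved:
  assumes I: "is_interval I" and flow: "ema_flow \<Omega> \<T> X Q \<Omega>h I 0 f u p"
    and curl: "\<forall>t\<in>I. \<exists>g. has_weak_curl \<Omega> (f t) g"
    and V1: "solves_V1 \<Omega> X Q I 0 f u w \<eta>"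
    and f0: "\<forall>t\<in>I. vanishes_on \<Omega> (f t)"
  shows "(\<lambda>t. ip \<Omega> (u t) (w t)) constant_on I"
proof (rule constant_on_if_zero_derivative[OF I])
  interpret ema_flow \<Omega> \<T> X Q \<Omega>h I 0 f u p by fact
  fix t assume t: "t \<in> I"
  have wX: "w s \<in> X" if "s \<in> I" for s using V1 that by (auto simp: solves_V1_def)
  have \<eta>Q: "\<eta> t \<in> Q" and pQ: "p t \<in> Q" using V1 discrete t by (auto simp: solves_V1_def)
  obtain ut where ut: "has_time_derivative \<Omega> I u t ut"
    and mom: "\<And>v. v \<in> X \<Longrightarrow> ip \<Omega> ut v + (conv \<Omega> (u t) (u t) v + conv \<Omega> v (u t) (u t))
        + ip \<Omega> (\<lambda>x. divg \<Omega> (u t) x *\<^sub>R u t x) v - ip \<Omega> (p t) (divg \<Omega> v)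
        + 0 * ip \<Omega> (grad \<Omega> (u t)) (grad \<Omega> v) = ip \<Omega> (f t) v"
    and udiv: "\<And>q. q \<in> Q \<Longrightarrow> ip \<Omega> q (divg \<Omega> (u t)) = 0"
    using ema_tested[OF t] by blast
  obtain wt where wt: "has_time_derivative \<Omega> I w t wt" and vort: "\<And>v q. v \<in> X \<Longrightarrow> q \<in> Q \<Longrightarrow>
      ip \<Omega> wt v + conv \<Omega> (u t) (w t) v - conv \<Omega> (w t) (u t) v
      + 0 * ip \<Omega> (grad \<Omega> (w t)) (grad \<Omega> v)
      + ip \<Omega> (\<eta> t) (divg \<Omega> v) - ip \<Omega> q (divg \<Omega> (w t)) = ip \<Omega> (wcurl \<Omega> (f t)) v"
    using V1 t unfolding solves_V1_def by blast
  have z: "ip \<Omega> (\<lambda>x. 0) (divg \<Omega> (w t)) = 0" by (simp add: ip_def)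
  \<comment> \<open>The vorticity is discretely divergence free for the same reason as
    \<open>u\<close>, so the pressure pairing with it vanishes.\<close>
  have wdiv: "ip \<Omega> q (divg \<Omega> (w t)) = 0" if "q \<in> Q" for q
    using vort[OF velocity_zero that] vort[OF velocity_zero pressure_zero] by (simp add: z)
  note uX = velocity_at[OF t]
  have fae: "AE x in lebesgue_on \<Omega>. f t x = 0" using f0 t by (auto simp: vanishes_on_def)
  have "ip \<Omega> (f t) (w t) = 0"
    by (rule ip_eq_0_AE) (use fae in eventually_elim, simp)
  \<comment> \<open>\<open>wcurl\<close> is a chosen representative, so its pairing is computed from
    the defining property of a weak curl.\<close>
  moreover have "ip \<Omega> (wcurl \<Omega> (f t)) (u t) = 0"
  proof (rule ip_wcurl_eq_0[OF lebesgue_domain])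
    show "f t \<in> L2 \<Omega>" using forcing t by blast
    show "has_weak_curl \<Omega> (f t) (wcurl \<Omega> (f t))"
      unfolding wcurl_def using curl t by (simp add: some_eq_ex)
    show "u t \<in> H10_vec \<Omega>" by (rule velocity_H10[OF uX])
    show "AE x in lebesgue_on \<Omega>. f t x = 0 \<or> grad \<Omega> (u t) x = 0"
      using fae by eventually_elim simp
  qed
  moreover have "conv \<Omega> (u t) (u t) (w t) + conv \<Omega> (u t) (w t) (u t)
      + ip \<Omega> (\<lambda>x. divg \<Omega> (u t) x *\<^sub>R u t x) (w t) = 0"
    using uX wX[OF t] by (intro transport_identity lebesgue_domain velocity_H10 velocity_Linf)
  ultimately have "ip \<Omega> ut (w t) + ip \<Omega> wt (u t) = 0"
    using mom[OF wX[OF t]] vort[OF uX pressure_zero] udiv[OF \<eta>Q] wdiv[OF pQ] z by simp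
  moreover have "((\<lambda>s. ip \<Omega> (u s) (w s)) has_real_derivative (ip \<Omega> ut (w t) + ip \<Omega> wt (u t))) (at t within I)"
    by (intro ip_time_derivative ut wt t velocity_L2 velocity_at wX)
  ultimately show "((\<lambda>s. ip \<Omega> (u s) (w s)) has_real_derivative 0) (at t within I)" by simp
qed

lemma has_time_derivative_const: "has_time_derivative \<Omega> I (\<lambda>t. c) t (\<lambda>x. 0)"
  by (simp add: has_time_derivative_def L2_zero l2norm_def ip_def)

text \<open>The constant field is not in \<open>X\<close>-tested form, so it is replaced by a cutoff
  \<open>c\<close>: the vorticity vanishes wherever the two may differ. Every term of (V2) tested
  with \<open>c\<close> other than the time derivative then cancels or vanishes.\<close>

lemma total_vorticity_conserved:
  assumes I: "is_interval I" and flow: "ema_flow \<Omega> \<T> X Q \<Omega>h I \<nu> f u p"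
    and curl: "\<forall>t\<in>I. \<exists>g. has_weak_curl \<Omega> (f t) g"
    and V2: "solves_V2 \<Omega> X Q I \<nu> f u w \<eta>"
    and w0: "\<forall>t\<in>I. vanishes_on (\<Omega> - \<Omega>h) (w t)" and \<eta>0: "\<forall>t\<in>I. vanishes_on (\<Omega> - \<Omega>h) (\<eta> t)"
  shows "(\<lambda>t. ip \<Omega> (w t) (\<lambda>x. axis k 1)) constant_on I"
proof -
  interpret ema_flow \<Omega> \<T> X Q \<Omega>h I \<nu> f u p by fact
  have wX: "w s \<in> X" if "s \<in> I" for s using V2 that by (auto simp: solves_V2_def)
  obtain c where c: "c \<in> X" and "AE x in lebesgue_on \<Omega>h. c x = axis k 1" using cutoff by blast
  then have c1: "AE x in lebesgue. x \<in> \<Omega>h \<longrightarrow> c x = axis k 1" by (simp add: AE_lebesgue_on[OF core_lebesgue])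
  have gradc: "AE x in lebesgue. x \<in> \<Omega>h \<longrightarrow> grad \<Omega> c x = 0" by (rule grad_core_eq_0[OF c c1])
  \<comment> \<open>On the strip \<open>h\<close> is 0 and on the core \<open>c\<close> is the
    coordinate vector, so pairing with \<open>c\<close> extracts a component almost
    everywhere.\<close>
  have pair: "AE x in lebesgue_on \<Omega>. h x \<bullet> c x = h x $ k"
    if "AE x in lebesgue. x \<in> \<Omega> - \<Omega>h \<longrightarrow> h x = 0" for h :: "real ^ 3 \<Rightarrow> real ^ 3"
    unfolding AE_lebesgue_on[OF lebesgue_domain] using that c1
    by eventually_elim (auto simp: inner_axis)
  have "(\<lambda>t. ip \<Omega> (w t) c) constant_on I"
  proof (rule constant_on_if_zero_derivative[OF I])
    fix t assume t: "t \<in> I"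
    note uX = velocity_at[OF t] and wXt = wX[OF t]
    obtain wt where wt: "has_time_derivative \<Omega> I w t wt" and vort: "\<And>v q. v \<in> X \<Longrightarrow> q \<in> Q \<Longrightarrow>
        ip \<Omega> wt v + conv \<Omega> (u t) (w t) v - conv \<Omega> (w t) (u t) v
        + ip \<Omega> (\<lambda>x. divg \<Omega> (u t) x *\<^sub>R w t x) v - ip \<Omega> (\<lambda>x. divg \<Omega> (w t) x *\<^sub>R u t x) v
        + \<nu> * ip \<Omega> (grad \<Omega> (w t)) (grad \<Omega> v)
        + ip \<Omega> (\<eta> t) (divg \<Omega> v) - ip \<Omega> q (divg \<Omega> (w t)) = ip \<Omega> (wcurl \<Omega> (f t)) v"
      using V2 t unfolding solves_V2_def by blast
    have van: "AE x in lebesgue. x \<in> \<Omega> - \<Omega>h \<longrightarrow> u t x = 0" "AE x in lebesgue. x \<in> \<Omega> - \<Omega>h \<longrightarrow> w t x = 0"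
      "AE x in lebesgue. x \<in> \<Omega> - \<Omega>h \<longrightarrow> \<eta> t x = 0" "AE x in lebesgue. x \<in> \<Omega> - \<Omega>h \<longrightarrow> f t x = 0"
      using vanish w0 \<eta>0 t unfolding vanishes_on_strip by blast+
    \<comment> \<open>The cutoff reduces this to the integral of the divergence of
      \<open>b $ k\<close> times \<open>a\<close>, which is zero because \<open>a\<close> has zero
      boundary values.\<close>
    have flux: "conv \<Omega> a b c + ip \<Omega> (\<lambda>x. divg \<Omega> a x *\<^sub>R b x) c = 0"
      if a: "a \<in> X" "AE x in lebesgue. x \<in> \<Omega> - \<Omega>h \<longrightarrow> a x = 0"
        and b: "b \<in> X" "AE x in lebesgue. x \<in> \<Omega> - \<Omega>h \<longrightarrow> b x = 0" for a b
    proof -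
      note L = velocity_L2 velocity_Linf velocity_H10
      have bk: "(\<lambda>x. b x $ k) \<in> H1 \<Omega>" by (intro H10_H1 H10_vecD L b)
      have "conv \<Omega> a b c = ip \<Omega> a (sgrad \<Omega> (\<lambda>x. b x $ k))"
        unfolding conv_def
      proof (rule ip_cong_AE)
        show "AE x in lebesgue_on \<Omega>. (grad \<Omega> b x *v a x) \<bullet> c x = a x \<bullet> sgrad \<Omega> (\<lambda>x. b x $ k) x"
          unfolding grad_mult_nth[symmetric] using a(2)
          by (intro pair) (auto elim: eventually_mono)
        show "(\<lambda>x. grad \<Omega> b x *v a x) \<in> borel_measurable (lebesgue_on \<Omega>)"
          by (intro L2_measurable grad_mult_L2 L a b)
      qed (intro L2_measurable L a c sgrad_L2 bk)+
      moreover have "ip \<Omega> (\<lambda>x. divg \<Omega> a x *\<^sub>R b x) c = ip \<Omega> (divg \<Omega> a) (\<lambda>x. b x $ k)"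
      proof (rule ip_cong_AE)
        have "AE x in lebesgue_on \<Omega>. (divg \<Omega> a x *\<^sub>R b x) \<bullet> c x = (divg \<Omega> a x *\<^sub>R b x) $ k"
          using b(2) by (intro pair) (auto elim: eventually_mono)
        then show "AE x in lebesgue_on \<Omega>. (divg \<Omega> a x *\<^sub>R b x) \<bullet> c x = divg \<Omega> a x \<bullet> b x $ k" by simp
        show "(\<lambda>x. divg \<Omega> a x *\<^sub>R b x) \<in> borel_measurable (lebesgue_on \<Omega>)"
          by (intro L2_measurable L2_scaleR_Linf divg_L2 L a b)
        show "divg \<Omega> a \<in> borel_measurable (lebesgue_on \<Omega>)"
          by (intro L2_measurable divg_L2 L a)
      qed (intro L2_measurable L c L2_component b)+
      ultimately show ?thesis
        using divg_integration_by_parts[OF lebesgue_domain velocity_H10[OF a(1)] bk] by simp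
    qed
    \<comment> \<open>The supports are complementary: one gradient vanishes on the strip, the other
      on the core. The multiplier and the forcing below are treated the same way.\<close>
    have "AE x in lebesgue_on \<Omega>. grad \<Omega> (w t) x = 0 \<or> grad \<Omega> c x = 0"
      unfolding AE_lebesgue_on[OF lebesgue_domain]
      using grad_strip_eq_0[OF wXt w0[rule_format, OF t]] gradc by eventually_elim auto
    then have visc: "ip \<Omega> (grad \<Omega> (w t)) (grad \<Omega> c) = 0"
      by (intro ip_eq_0_AE) (auto elim: eventually_mono)
    have "AE x in lebesgue_on \<Omega>. \<eta> t x = 0 \<or> grad \<Omega> c x = 0"
      unfolding AE_lebesgue_on[OF lebesgue_domain]
      using van(3) gradc by eventually_elim auto
    then have mult: "ip \<Omega> (\<eta> t) (divg \<Omega> c) = 0"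
      by (intro ip_eq_0_AE) (auto simp: divg_def grad_def vec_eq_iff elim!: eventually_mono)
    have force: "ip \<Omega> (wcurl \<Omega> (f t)) c = 0"
    proof (rule ip_wcurl_eq_0[OF lebesgue_domain])
      show "f t \<in> L2 \<Omega>" using forcing t by blast
      show "has_weak_curl \<Omega> (f t) (wcurl \<Omega> (f t))"
        unfolding wcurl_def using curl t by (simp add: some_eq_ex)
      show "c \<in> H10_vec \<Omega>" by (rule velocity_H10[OF c])
      show "AE x in lebesgue_on \<Omega>. f t x = 0 \<or> grad \<Omega> c x = 0"
        unfolding AE_lebesgue_on[OF lebesgue_domain]
        using van(4) gradc by eventually_elim auto
    qed
    have "ip \<Omega> (\<lambda>x. 0) (divg \<Omega> (w t)) = 0" by (simp add: ip_def)
    then have "ip \<Omega> wt c = 0"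
      \<comment> \<open>The two divergence terms added in (V2) complete both convective terms to
        fluxes, one for each order of \<open>u\<close> and \<open>w\<close>.\<close>
      using vort[OF c pressure_zero] flux[OF uX van(1) wXt van(2)] flux[OF wXt van(2) uX van(1)]
        visc mult force by simp
    moreover have "((\<lambda>s. ip \<Omega> (w s) c) has_real_derivative (ip \<Omega> wt c + ip \<Omega> (\<lambda>x. 0) (w t))) (at t within I)"
      by (intro ip_time_derivative[where w = "\<lambda>t. c"] wt t velocity_L2 wX c has_time_derivative_const)
    ultimately show "((\<lambda>s. ip \<Omega> (w s) c) has_real_derivative 0) (at t within I)"
      by (simp add: ip_def)
  qed
  moreover have "ip \<Omega> (w t) (\<lambda>x. axis k 1) = ip \<Omega> (w t) c" if t: "t \<in> I" for t
  proof (rule ip_cong_AE)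
    have "AE x in lebesgue_on \<Omega>. w t x \<bullet> c x = w t x $ k"
      using w0 t unfolding vanishes_on_strip by (intro pair) blast
    then show "AE x in lebesgue_on \<Omega>. w t x \<bullet> axis k 1 = w t x \<bullet> c x"
      by eventually_elim (simp add: inner_axis)
  qed (intro L2_measurable velocity_L2 wX c t measurable_const, simp?)+
  ultimately show ?thesis by (simp add: constant_on_def)
qed

text \<open>For \<open>b = c = w\<close> the scalar transport identity says that twice the
  convective term plus the divergence term is zero. The factor 1/2 in (V3) matches exactly this, so
  testing with \<open>w\<close> leaves only the time derivative.\<close>

lemma enstrophy_conserved:
  assumes I: "is_interval I" and flow: "ema_flow \<Omega> \<T> X Q \<Omega>h I 0 f u p"
    and Y: "fe_space \<T> Y" "Y \<subseteq> H10 \<Omega>" and V3: "solves_V3 \<Omega> Y I 0 f u w"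
    and curl0: "\<forall>t\<in>I. vanishes_on \<Omega> (wcurl_2D \<Omega> (f t))"
  shows "(\<lambda>t. 1/2 * (l2norm \<Omega> (w t))\<^sup>2) constant_on I"
proof (rule constant_on_if_zero_derivative[OF I])
  interpret ema_flow \<Omega> \<T> X Q \<Omega>h I 0 f u p by fact
  fix t assume t: "t \<in> I"
  have wY: "w s \<in> Y" if "s \<in> I" for s using V3 that by (auto simp: solves_V3_def)
  have wH: "w s \<in> H10 \<Omega>" if "s \<in> I" for s using wY[OF that] Y(2) by blast
  have wL: "w s \<in> L2 \<Omega>" if "s \<in> I" for s using wH[OF that] by (rule H10_L2)
  have wLinf: "w t \<in> Linf \<Omega>" by (rule fe_space_Linf[OF Y(1) wY[OF t] wL[OF t]])
  obtain wt where wt: "has_time_derivative \<Omega> I w t wt" and vort: "\<And>v. v \<in> Y \<Longrightarrow>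
      ip \<Omega> wt v + ip \<Omega> (\<lambda>x. u t x \<bullet> sgrad \<Omega> (w t) x) v + 0 * ip \<Omega> (sgrad \<Omega> (w t)) (sgrad \<Omega> v)
      + 1/2 * ip \<Omega> (\<lambda>x. divg \<Omega> (u t) x * w t x) v = ip \<Omega> (wcurl_2D \<Omega> (f t)) v"
    using V3 t unfolding solves_V3_def by blast
  note uX = velocity_at[OF t]
  have "ip \<Omega> (wcurl_2D \<Omega> (f t)) (w t) = 0"
    using curl0 t unfolding vanishes_on_def by (intro ip_eq_0_AE) (auto elim: eventually_mono)
  moreover have "ip \<Omega> (\<lambda>x. u t x \<bullet> sgrad \<Omega> (w t) x) (w t) + ip \<Omega> (\<lambda>x. u t x \<bullet> sgrad \<Omega> (w t) x) (w t)
      + ip \<Omega> (\<lambda>x. divg \<Omega> (u t) x * w t x) (w t) = 0"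
    by (intro scalar_transport_identity lebesgue_domain velocity_H10 velocity_Linf uX wH wLinf t)
  ultimately have "ip \<Omega> wt (w t) = 0" using vort[OF wY[OF t]] by simp
  moreover have "((\<lambda>s. ip \<Omega> (w s) (w s)) has_real_derivative (ip \<Omega> wt (w t) + ip \<Omega> wt (w t))) (at t within I)"
    by (intro ip_time_derivative wt t wL)
  ultimately have "((\<lambda>s. 1/2 * ip \<Omega> (w s) (w s)) has_real_derivative 1/2 * 0) (at t within I)"
    by (intro DERIV_cmult) simp
  then show "((\<lambda>t. 1/2 * (l2norm \<Omega> (w t))\<^sup>2) has_real_derivative 0) (at t within I)"
    by (simp add: l2norm_def ip_self_nonneg)
qed

theorem proposition3p2:
  fixes I :: "real set" and \<nu> :: real
  assumes "is_interval I" and "\<nu> \<ge> 0"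
  shows
   "(\<forall>(\<Omega> :: (real ^ 3) set) \<T> X Q \<Omega>h f u p.
       ema_flow \<Omega> \<T> X Q \<Omega>h I \<nu> f u p \<and> (\<forall>t\<in>I. \<exists>g. has_weak_curl \<Omega> (f t) g) \<longrightarrow>
       (\<forall>w1 \<eta>1. solves_V1 \<Omega> X Q I \<nu> f u w1 \<eta>1
            \<and> (\<forall>t\<in>I. vanishes_on (\<Omega> - \<Omega>h) (w1 t))
            \<and> (\<forall>t\<in>I. vanishes_on \<Omega> (f t)) \<and> \<nu> = 0 \<longrightarrow>
          (\<lambda>t. ip \<Omega> (u t) (w1 t)) constant_on I)
     \<and> (\<forall>w2 \<eta>2. solves_V2 \<Omega> X Q I \<nu> f u w2 \<eta>2
            \<and> (\<forall>t\<in>I. vanishes_on (\<Omega> - \<Omega>h) (w2 t) \<and> vanishes_on (\<Omega> - \<Omega>h) (\<eta>2 t)) \<longrightarrow>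
          (\<forall>i. (\<lambda>t. ip \<Omega> (w2 t) (\<lambda>x. axis i 1)) constant_on I)))
  \<and> (\<forall>(\<Omega> :: (real ^ 2) set) \<T> X Q \<Omega>h f u p.
       ema_flow \<Omega> \<T> X Q \<Omega>h I \<nu> f u p \<and> (\<forall>t\<in>I. \<exists>g. has_weak_curl_2D \<Omega> (f t) g) \<longrightarrow>
       (\<forall>Y w. fe_space \<T> Y \<and> Y \<subseteq> H10 \<Omega> \<and> solves_V3 \<Omega> Y I \<nu> f u w
            \<and> (\<forall>t\<in>I. vanishes_on (\<Omega> - \<Omega>h) (w t))
            \<and> (\<forall>t\<in>I. vanishes_on \<Omega> (wcurl_2D \<Omega> (f t))) \<and> \<nu> = 0 \<longrightarrow>
          (\<lambda>t. 1/2 * (l2norm \<Omega> (w t))\<^sup>2) constant_on I))"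
proof (intro conjI allI impI; elim conjE)
  fix \<Omega> :: "(real ^ 3) set" and \<T> X Q \<Omega>h f u p w1 \<eta>1
  assume "ema_flow \<Omega> \<T> X Q \<Omega>h I \<nu> f u p" "\<forall>t\<in>I. \<exists>g. has_weak_curl \<Omega> (f t) g"
    and "solves_V1 \<Omega> X Q I \<nu> f u w1 \<eta>1" "\<forall>t\<in>I. vanishes_on \<Omega> (f t)" "\<nu> = 0"
  then show "(\<lambda>t. ip \<Omega> (u t) (w1 t)) constant_on I"
    by (intro helicity_conserved[OF assms(1)]) simp_all
next
  fix \<Omega> :: "(real ^ 3) set" and \<T> X Q \<Omega>h f u p w2 \<eta>2 and i :: 3
  assume "ema_flow \<Omega> \<T> X Q \<Omega>h I \<nu> f u p" "\<forall>t\<in>I. \<exists>g. has_weak_curl \<Omega> (f t) g"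
    and "solves_V2 \<Omega> X Q I \<nu> f u w2 \<eta>2"
    and "\<forall>t\<in>I. vanishes_on (\<Omega> - \<Omega>h) (w2 t) \<and> vanishes_on (\<Omega> - \<Omega>h) (\<eta>2 t)"
  then show "(\<lambda>t. ip \<Omega> (w2 t) (\<lambda>x. axis i 1)) constant_on I"
    by (intro total_vorticity_conserved[OF assms(1)]) blast+
next
  fix \<Omega> :: "(real ^ 2) set" and \<T> X Q \<Omega>h f u p Y w
  assume "ema_flow \<Omega> \<T> X Q \<Omega>h I \<nu> f u p" "fe_space \<T> Y" "Y \<subseteq> H10 \<Omega>"
    and "solves_V3 \<Omega> Y I \<nu> f u w" "\<forall>t\<in>I. vanishes_on \<Omega> (wcurl_2D \<Omega> (f t))" "\<nu> = 0"
  then show "(\<lambda>t. 1/2 * (l2norm \<Omega> (w t))\<^sup>2) constant_on I"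
    by (intro enstrophy_conserved[OF assms(1)]) simp_all
qed

end
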